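(* Let $\Omega$ and $\{(\Omega_h,\mathcal T_h)\}_h$ be as in the context. For $N_h\in X(\mathcal T_h)$ write $N_{h,nn}|_e=\mu_e^0+\mu_e^1\ell_e$ with $\mu_e^0,\mu_e^1\in\mathbb R$ for each $e\in\mathcal E_h^\partial$, and put $$p_h^1:=\sum_{e\in\mathcal E_h^\partial}h_e\,\mu_e^1\,b_e\,n_e .$$ Then $\operatorname{sCurl}p_h^1\in X(\mathcal T_h)\cap\ker(\operatorname{divdiv})$, $$(\operatorname{sCurl}p_h^1)_{nn}|_e=\mu_e^1\ell_e,\qquad q_n(\operatorname{sCurl}p_h^1)|_e=0\qquad\forall e\in\mathcal E_h^\partial,$$ and, with a constant $C$ independent of $h$ and $N_h$, $$\|\operatorname{sCurl}p_h^1\|_{L^2(\Omega_h)}\le C\Bigl(\sum_{e\in\mathcal E_h^\partial}h_e^2|\mu_e^1|^2\Bigr)^{1/2}.$$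
   Context: Geometry and meshes. $\Omega\subset\mathbb R^2$ is a bounded connected Lipschitz domain whose boundary has finitely many connected components, $\Gamma:=\partial\Omega=\bigcup_{i=0}^{H}\Gamma^{(i)}$. For every sufficiently small mesh size $h$, $\Omega_h$ is a bounded polygonal Lipschitz domain with boundary $\Gamma_h=\bigcup_{i=0}^{H}\Gamma_h^{(i)}$ and $\mathcal T_h$ is a conforming triangulation of $\Omega_h$. $\mathcal E_h^\partial$ and $\mathcal V_h^\partial$ are the sets of boundary edges and boundary vertices, $h_K:=\operatorname{diam}K$, $h_e:=|e|$, $h:=\max_{K}h_K$. Each $\Gamma^{(i)}$ is oriented so that $\Omega$ lies to its right, and $\Gamma_h^{(i)}$ is oriented as $\Gamma^{(i)}$; on $e\in\mathcal E_h^\partial$, $t=t_e$ and $n=n_e$ are the constant unit tangent and outward unit normal (so $n_e$ is $t_e$ rotated counterclockwise by $\pi/2$). Mesh assumption: $\{\mathcal T_h\}_h$ is uniformly shape regular and quasi-uniform, $h\to0$ and $\Gamma_h\to\Gamma$ in Hausdorff distance; on each component the vertices of $\Gamma_h^{(i)}$ lie on $\Gamma^{(i)}$ in the same cyclic order, with consecutive vertices joined by boundary edges (so $\mathcal V_h^\partial\subset\Gamma$). Notation. $\mathbb S$: symmetric $2\times2$ real matrices; $\operatorname{div}$ acts row-wise on tensors; $\operatorname{divdiv}N:=\operatorname{div}(\operatorname{div}N)$ (distributional); $H(\operatorname{divdiv},\omega;\mathbb S):=\{N\in L^2(\omega;\mathbb S):\operatorname{divdiv}N\in L^2(\omega)\}$.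 On a straight edge: $N_{nn}:=n^\top Nn$, $N_{nt}:=n^\top Nt$, $q_n(N):=n\cdot\operatorname{div}N+\partial_tN_{nt}$ (computed from the adjacent element). For $p=(p_1,p_2)^\top$, $\operatorname{Curl}p:=\begin{pmatrix}\partial_2p_1&-\partial_1p_1\\ \partial_2p_2&-\partial_1p_2\end{pmatrix}$ and $\operatorname{sCurl}p:=\frac12(\operatorname{Curl}p+(\operatorname{Curl}p)^\top)$. Spaces and bubbles. $\operatorname{RT}^k(K):=\mathbb P_k(K;\mathbb R^2)+x\,\mathbb P_k(K)$, $X(K):=\operatorname{sym}(\operatorname{RT}^0(K)\otimes\operatorname{RT}^1(K))$, where $U\otimes V$ is the span of $\{\phi\psi^\top:\phi\in U,\psi\in V\}$ and $\operatorname{sym}Q:=(Q+Q^\top)/2$; for $N\in X(K)$ and an edge $e$ of $K$, $N_{nn}|_e\in\mathbb P_1(e)$. $X(\mathcal T_h):=\{N_h\in H(\operatorname{divdiv},\Omega_h;\mathbb S):N_h|_K\in X(K)\ \forall K\in\mathcal T_h\}$. For $e=[z_i,z_j]\in\mathcal E_h^\partial$ with adjacent element $K_e$, $b_e:=\lambda_i\lambda_j$ on $K_e$ (barycentric coordinates of $K_e$ associated with $z_i,z_j$), extended by zero elsewhere. With $s\in[0,h_e]$ the arclength on $e$ measured from its initial endpoint, $\ell_e:=2s/h_e-1$. *)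

theory Defs
  imports "HOL-Analysis.Analysis"
begin

section \<open>Planar geometry\<close>

(* Rotation by pi/2, counterclockwise. *)
definition rot :: "real^2 \<Rightarrow> real^2" where
  "rot v = vector [- v$2, v$1]"

(* In the plane every orthonormal frame has the form (u, rot u) up to the sign of u,
   which can be absorbed into g. *)
definition lipschitz_domain :: "(real^2) set \<Rightarrow> bool" where
  "lipschitz_domain \<Omega> \<longleftrightarrow> \<Omega> \<noteq> {} \<and> open \<Omega> \<and> connected \<Omega> \<and> bounded \<Omega> \<and>
     (\<forall>x\<in>frontier \<Omega>. \<exists>u r L. \<exists>g::real \<Rightarrow> real. norm u = 1 \<and> r > 0 \<and> L-lipschitz_on UNIV g \<and>
        \<Omega> \<inter> ball x r = {y \<in> ball x r. g (y \<bullet> u) < y \<bullet> rot u})"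

definition polygonal_lipschitz_domain :: "(real^2) set \<Rightarrow> bool" where
  "polygonal_lipschitz_domain \<Omega> \<longleftrightarrow> lipschitz_domain \<Omega> \<and>
     (\<exists>S. finite S \<and> frontier \<Omega> = (\<Union>(a, b)\<in>S. closed_segment a b))"

(* The tangent of a Lipschitz curve exists almost everywhere only; the region lies to the
   right if, at almost every parameter, short displacements in direction - rot v
   (v the tangent) enter it. *)
definition oriented_boundary_param ::
    "(real^2) set \<Rightarrow> (real^2) set \<Rightarrow> (real \<Rightarrow> real^2) \<Rightarrow> bool" where
  "oriented_boundary_param \<Omega> \<Gamma> \<gamma> \<longleftrightarrow>
     simple_path \<gamma> \<and> pathfinish \<gamma> = pathstart \<gamma> \<and> path_image \<gamma> = \<Gamma> \<and>
     (\<exists>L. L-lipschitz_on {0..1} \<gamma>) \<and>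
     (AE s in lebesgue_on {0..1}. \<exists>v. v \<noteq> 0 \<and> (\<gamma> has_vector_derivative v) (at s) \<and>
        (\<forall>\<^sub>F \<epsilon> in at_right 0. \<gamma> s - \<epsilon> *\<^sub>R rot v \<in> \<Omega>))"

definition hausdorff_dist :: "(real^2) set \<Rightarrow> (real^2) set \<Rightarrow> real" where
  "hausdorff_dist A B = max (SUP a\<in>A. infdist a B) (SUP b\<in>B. infdist b A)"

section \<open>Triangulations\<close>

definition conforming_triangulation :: "(real^2) set \<Rightarrow> (real^2) set set \<Rightarrow> bool" where
  "conforming_triangulation \<Omega> T \<longleftrightarrow>
     triangulation T \<and> (\<forall>K\<in>T. 2 simplex K) \<and> \<Union>T = closure \<Omega>"

definition vertices :: "(real^2) set \<Rightarrow> (real^2) set" where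
  "vertices K = {v. v extreme_point_of K}"

definition boundary_vertices :: "(real^2) set \<Rightarrow> (real^2) set set \<Rightarrow> (real^2) set" where
  "boundary_vertices \<Omega> T = (\<Union>K\<in>T. vertices K) \<inter> frontier \<Omega>"

type_synonym edge = "(real^2) \<times> (real^2)"

(* A boundary edge is the ordered pair (initial endpoint, final endpoint) for the orientation
   that has the domain on its right: the third vertex c of the adjacent triangle lies to the
   right of the line from a to b. Each geometric boundary edge occurs as exactly one pair. *)
definition boundary_edges :: "(real^2) set \<Rightarrow> (real^2) set set \<Rightarrow> edge set" where
  "boundary_edges \<Omega> T = {(a, b). closed_segment a b \<subseteq> frontier \<Omega> \<and>
     (\<exists>c. convex hull {a, b, c} \<in> T \<and> rot (b - a) \<bullet> (c - a) < 0)}"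

definition edge_set :: "edge \<Rightarrow> (real^2) set" where
  "edge_set e = closed_segment (fst e) (snd e)"

definition edge_length :: "edge \<Rightarrow> real" where
  "edge_length e = dist (fst e) (snd e)"

definition edge_tangent :: "edge \<Rightarrow> real^2" where
  "edge_tangent e = (snd e - fst e) /\<^sub>R edge_length e"

(* Outward, since the domain lies to the right of e. *)
definition edge_normal :: "edge \<Rightarrow> real^2" where
  "edge_normal e = rot (edge_tangent e)"

definition edge_ell :: "edge \<Rightarrow> real^2 \<Rightarrow> real" where
  "edge_ell e x = 2 * dist (fst e) x / edge_length e - 1"

definition adj_elem :: "(real^2) set set \<Rightarrow> edge \<Rightarrow> (real^2) set" where
  "adj_elem T e = (THE K. K \<in> T \<and> edge_set e \<subseteq> K)"

(* Barycentric coordinates with respect to the affinely independent set V;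
   barycentric V x v is the coordinate of x associated with v. *)
definition barycentric :: "(real^2) set \<Rightarrow> real^2 \<Rightarrow> real^2 \<Rightarrow> real" where
  "barycentric V x = (THE u. (\<forall>v. v \<notin> V \<longrightarrow> u v = 0) \<and> sum u V = 1 \<and> (\<Sum>v\<in>V. u v *\<^sub>R v) = x)"

definition edge_bubble :: "(real^2) set set \<Rightarrow> edge \<Rightarrow> real^2 \<Rightarrow> real" where
  "edge_bubble T e x = (let K = adj_elem T e in
     if x \<in> K then barycentric (vertices K) x (fst e) * barycentric (vertices K) x (snd e) else 0)"

section \<open>Mesh families\<close>

text \<open>A family is indexed by the set \<open>hs\<close> of its mesh sizes.\<close>

definition inball_diameter :: "(real^2) set \<Rightarrow> real" where
  "inball_diameter K = Sup {2 * r | r. r \<ge> 0 \<and> (\<exists>x. cball x r \<subseteq> K)}"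

definition shape_regular :: "real set \<Rightarrow> (real \<Rightarrow> (real^2) set set) \<Rightarrow> bool" where
  "shape_regular hs T \<longleftrightarrow>
     (\<exists>\<sigma>. \<forall>h\<in>hs. \<forall>K\<in>T h. diameter K \<le> \<sigma> * inball_diameter K)"

definition quasi_uniform :: "real set \<Rightarrow> (real \<Rightarrow> (real^2) set set) \<Rightarrow> bool" where
  "quasi_uniform hs T \<longleftrightarrow> (\<exists>c>0. \<forall>h\<in>hs. \<forall>K\<in>T h. c * h \<le> diameter K)"

(* Gh is a boundary component of the polygonal domain \<Omega>h. Since boundary_edges consists of
   pairs directed with \<Omega>h on the right, the last conjunct also says that Gh is
   oriented as \<gamma>. *)
definition inscribed_along ::
    "(real \<Rightarrow> real^2) \<Rightarrow> (real^2) set \<Rightarrow> (real^2) set set \<Rightarrow> (real^2) set \<Rightarrow> bool" where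
  "inscribed_along \<gamma> \<Omega>h T Gh \<longleftrightarrow>
     (\<exists>(m::nat) (s::nat \<Rightarrow> real). m > 0 \<and> s ` {..<m} \<subseteq> {0..<1} \<and> strict_mono_on {..<m} s \<and>
        boundary_vertices \<Omega>h T \<inter> Gh = (\<lambda>j. \<gamma> (s j)) ` {..<m} \<and>
        (\<forall>j<m. (\<gamma> (s j), \<gamma> (s (Suc j mod m))) \<in> boundary_edges \<Omega>h T))"

section \<open>Differential operators\<close>

definition dir_deriv :: "real^2 \<Rightarrow> (real^2 \<Rightarrow> real) \<Rightarrow> real^2 \<Rightarrow> real" where
  "dir_deriv v f x = deriv (\<lambda>s. f (x + s *\<^sub>R v)) 0"

definition partial :: "2 \<Rightarrow> (real^2 \<Rightarrow> real) \<Rightarrow> real^2 \<Rightarrow> real" where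
  "partial j = dir_deriv (axis j 1)"

definition div_rows :: "(real^2 \<Rightarrow> real^2^2) \<Rightarrow> real^2 \<Rightarrow> real^2" where
  "div_rows N x = (\<chi> i. \<Sum>j\<in>UNIV. partial j (\<lambda>y. N y $ i $ j) x)"

definition sym_part :: "real^2^2 \<Rightarrow> real^2^2" where
  "sym_part Q = (1/2) *\<^sub>R (Q + transpose Q)"

definition Curl :: "(real^2 \<Rightarrow> real^2) \<Rightarrow> real^2 \<Rightarrow> real^2^2" where
  "Curl p x = vector [vector [partial 2 (\<lambda>y. p y $ 1) x, - partial 1 (\<lambda>y. p y $ 1) x],
                      vector [partial 2 (\<lambda>y. p y $ 2) x, - partial 1 (\<lambda>y. p y $ 2) x]]"

definition sCurl :: "(real^2 \<Rightarrow> real^2) \<Rightarrow> real^2 \<Rightarrow> real^2^2" where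
  "sCurl p x = sym_part (Curl p x)"

section \<open>Distributional derivatives and function spaces\<close>

definition L2 :: "(real^2) set \<Rightarrow> (real^2 \<Rightarrow> 'a::euclidean_space) set" where
  "L2 \<omega> = {f. f \<in> borel_measurable (lebesgue_on \<omega>) \<and> integrable (lebesgue_on \<omega>) (\<lambda>x. (norm (f x))\<^sup>2)}"

(* On real^2^2 the library norm is the Frobenius norm. *)
definition L2_norm :: "(real^2) set \<Rightarrow> (real^2 \<Rightarrow> 'a::euclidean_space) \<Rightarrow> real" where
  "L2_norm \<omega> f = sqrt (LINT x|lebesgue_on \<omega>. (norm (f x))\<^sup>2)"

definition smooth :: "(real^2 \<Rightarrow> real) \<Rightarrow> bool" where
  "smooth f \<longleftrightarrow> (\<forall>js x. foldr partial js f differentiable (at x))"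

definition test_functions :: "(real^2) set \<Rightarrow> (real^2 \<Rightarrow> real) set" where
  "test_functions \<omega> = {\<phi>. smooth \<phi> \<and> compact (closure {x. \<phi> x \<noteq> 0}) \<and> closure {x. \<phi> x \<noteq> 0} \<subseteq> \<omega>}"

definition has_weak_partial ::
    "(real^2) set \<Rightarrow> 2 \<Rightarrow> (real^2 \<Rightarrow> real) \<Rightarrow> (real^2 \<Rightarrow> real) \<Rightarrow> bool" where
  "has_weak_partial \<omega> j f g \<longleftrightarrow> (\<forall>\<phi>\<in>test_functions \<omega>.
     (LINT x|lebesgue_on \<omega>. f x * partial j \<phi> x) = - (LINT x|lebesgue_on \<omega>. g x * \<phi> x))"

(* p is in H^1(\<omega>) and its distributional partial derivatives are the classical ones
   (which need to exist only almost everywhere). This makes Curl p and sCurl p, built from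
   classical derivatives, the distributional ones. *)
definition weakly_differentiable_L2 :: "(real^2) set \<Rightarrow> (real^2 \<Rightarrow> real^2) \<Rightarrow> bool" where
  "weakly_differentiable_L2 \<omega> p \<longleftrightarrow> p \<in> L2 \<omega> \<and>
     (\<forall>i j. partial j (\<lambda>y. p y $ i) \<in> L2 \<omega> \<and>
        has_weak_partial \<omega> j (\<lambda>y. p y $ i) (partial j (\<lambda>y. p y $ i)))"

(* g is the distribution div (div N) on \<omega>. *)
definition has_weak_divdiv ::
    "(real^2) set \<Rightarrow> (real^2 \<Rightarrow> real^2^2) \<Rightarrow> (real^2 \<Rightarrow> real) \<Rightarrow> bool" where
  "has_weak_divdiv \<omega> N g \<longleftrightarrow> (\<forall>\<phi>\<in>test_functions \<omega>.
     (LINT x|lebesgue_on \<omega>. (\<Sum>i\<in>UNIV. \<Sum>j\<in>UNIV. N x $ i $ j * partial i (partial j \<phi>) x))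
       = (LINT x|lebesgue_on \<omega>. g x * \<phi> x))"

definition H_divdiv :: "(real^2) set \<Rightarrow> (real^2 \<Rightarrow> real^2^2) set" where
  "H_divdiv \<omega> = {N \<in> L2 \<omega>. (AE x in lebesgue_on \<omega>. transpose (N x) = N x) \<and>
     (\<exists>g \<in> L2 \<omega>. has_weak_divdiv \<omega> N g)}"

definition ker_divdiv :: "(real^2) set \<Rightarrow> (real^2 \<Rightarrow> real^2^2) set" where
  "ker_divdiv \<omega> = {N \<in> H_divdiv \<omega>. has_weak_divdiv \<omega> N (\<lambda>_. 0)}"

section \<open>Polynomial spaces\<close>

text \<open>Polynomials on a triangle are represented by their unique extensions to the plane,
  so the local spaces do not carry the triangle as an argument.\<close>

definition Pk :: "nat \<Rightarrow> (real^2 \<Rightarrow> real) set" where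
  "Pk k = {f. \<exists>c. f = (\<lambda>x. \<Sum>i\<le>k. \<Sum>j\<le>k - i. c i j * (x$1) ^ i * (x$2) ^ j)}"

definition RT :: "nat \<Rightarrow> (real^2 \<Rightarrow> real^2) set" where
  "RT k = {\<lambda>x. q x + r x *\<^sub>R x | q r. (\<forall>i. (\<lambda>x. q x $ i) \<in> Pk k) \<and> r \<in> Pk k}"

definition outer :: "real^2 \<Rightarrow> real^2 \<Rightarrow> real^2^2" where
  "outer u v = (\<chi> i j. u $ i * v $ j)"

(* The linear span, spelled out because functions are not an instance of real_vector. *)
definition tensor_span ::
    "(real^2 \<Rightarrow> real^2) set \<Rightarrow> (real^2 \<Rightarrow> real^2) set \<Rightarrow> (real^2 \<Rightarrow> real^2^2) set" where
  "tensor_span U V = {\<lambda>x. \<Sum>l<(m::nat). a l *\<^sub>R outer (\<phi> l x) (\<psi> l x) | m a \<phi> \<psi>.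
     \<forall>l<m. \<phi> l \<in> U \<and> \<psi> l \<in> V}"

definition X_local :: "(real^2 \<Rightarrow> real^2^2) set" where
  "X_local = {\<lambda>x. sym_part (Q x) | Q. Q \<in> tensor_span (RT 0) (RT 1)}"

definition X_space :: "(real^2) set \<Rightarrow> (real^2) set set \<Rightarrow> (real^2 \<Rightarrow> real^2^2) set" where
  "X_space \<Omega> T = {N \<in> H_divdiv \<Omega>. \<forall>K\<in>T. \<exists>Q\<in>X_local. AE x in lebesgue_on K. N x = Q x}"

(* The polynomial that represents N on K; for N in X_space it exists and is unique, and it
   gives a meaning to the traces of N on the edges of K. *)
definition elem_poly :: "(real^2) set \<Rightarrow> (real^2 \<Rightarrow> real^2^2) \<Rightarrow> real^2 \<Rightarrow> real^2^2" where
  "elem_poly K N = (THE Q. Q \<in> X_local \<and> (AE x in lebesgue_on K. N x = Q x))"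

definition trace_nn ::
    "(real^2) set set \<Rightarrow> edge \<Rightarrow> (real^2 \<Rightarrow> real^2^2) \<Rightarrow> real^2 \<Rightarrow> real" where
  "trace_nn T e N x = (let n = edge_normal e in n \<bullet> (elem_poly (adj_elem T e) N x *v n))"

definition trace_qn ::
    "(real^2) set set \<Rightarrow> edge \<Rightarrow> (real^2 \<Rightarrow> real^2^2) \<Rightarrow> real^2 \<Rightarrow> real" where
  "trace_qn T e N x = (let n = edge_normal e; t = edge_tangent e; Q = elem_poly (adj_elem T e) N in
     n \<bullet> div_rows Q x + dir_deriv t (\<lambda>y. n \<bullet> (Q y *v t)) x)"

definition bubble_field :: "(real^2) set \<Rightarrow> (real^2) set set \<Rightarrow> (edge \<Rightarrow> real) \<Rightarrow> real^2 \<Rightarrow> real^2" where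
  "bubble_field \<Omega> T \<mu> x = (\<Sum>e\<in>boundary_edges \<Omega> T. (edge_length e * \<mu> e * edge_bubble T e x) *\<^sub>R edge_normal e)"

end

theory Submission
  imports Defs
begin

text \<open>
  Everything is read off one bubble at a time. For a boundary edge \<open>e\<close> with adjacent triangle
  \<open>K\<close>, unit tangent \<open>t\<close> and normal \<open>n = rot t\<close>, the bubble \<open>b\<close> is on \<open>K\<close> a product of two
  barycentric coordinates, and \<open>Curl (b n)\<close> is the rank-one tensor \<open>n (- rot (\<nabla>b))\<^sup>T\<close>, a
  constant vector times an affine one. Its symmetric part therefore lies in the local space
  (\<open>sum_sym_outer_in_X_local\<close>).

  Kernel of divdiv. The field \<open>p\<close> jumps to zero across \<open>\<partial>\<Omega>\<close>, but inside \<open>\<Omega>\<close> it is weakly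
  differentiable: for a test function \<open>\<phi>\<close> the product \<open>b \<phi>\<close> vanishes on all of \<open>\<partial>K\<close>, on two
  sides because of \<open>b\<close> and on \<open>e\<close> because of \<open>\<phi>\<close>, so its extension by zero is Lipschitz with
  compact support, and the integral of any directional derivative of such a function is zero
  (\<open>integral_directional_derivative_eq_0\<close>, \<open>bubble_weak_partial\<close>). Pairing \<open>sCurl p\<close> with a
  Hessian and moving one derivative back leaves third derivatives of \<open>\<phi>\<close> that cancel by symmetry
  (\<open>weak_divdiv_sCurl\<close>).

  Traces. For a single term \<open>sym (m (- rot (\<nabla>b))\<^sup>T)\<close> the normal-normal component on a line with
  tangent \<open>t\<close> is \<open>- (n \<bullet> m) \<partial>\<^sub>t b\<close> and \<open>q\<^sub>n\<close> is \<open>- (m \<bullet> t) \<partial>\<^sub>t\<partial>\<^sub>t b\<close> (\<open>nn_sym_outer\<close>,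
  \<open>qn_form_sym_outer\<close>). For the bubble of \<open>e\<close> itself \<open>m = n\<close>, so the second vanishes and the first
  equals \<open>\<ell> / |e|\<close>, which the factor \<open>|e| \<mu>\<close> turns into \<open>\<mu> \<ell>\<close>. A triangle may have further boundary
  edges; their bubbles vanish identically along \<open>e\<close> and contribute nothing
  (\<open>other_bubble_on_edge\<close>).

  Two facts about the mesh make this bookkeeping legitimate: a boundary edge lies in exactly one
  triangle (\<open>unique_element_at_boundary_edge\<close>, which rests on a Lipschitz domain lying on one side
  of its boundary), and a polynomial tensor on a triangle is determined by its values almost
  everywhere there (\<open>X_local_eq_if_AE_eq\<close>), so the traces of \<open>sCurl p\<close> are those of the explicit
  sum \<open>element_tensor\<close>.

  Stability. A barycentric coordinate ranges in \<open>[0, 1]\<close>, hence its gradient has norm at most the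
  reciprocal of the inball diameter (\<open>norm_bary_grad_inball\<close>). Shape regularity bounds
  \<open>|\<nabla>b|\<^sup>2\<close> times the area of \<open>K\<close> by a constant, and a triangle carries boundedly many edges,
  so the squared norm of \<open>sCurl p\<close> is at most a constant times the sum of the squared weights.
\<close>

section \<open>Integration by parts for Lipschitz functions\<close>

text \<open>The difference quotients of \<open>F\<close> have integral zero by translation invariance. They are bounded
  by the Lipschitz constant on a fixed ball and vanish outside it, so dominated convergence passes
  to the limit, which is the derivative almost everywhere. This replaces the divergence theorem.\<close>

lemma integral_directional_derivative_eq_0:
  fixes F G :: "'a::euclidean_space \<Rightarrow> real"
  assumes lip: "L-lipschitz_on UNIV F" and supp: "\<And>x. F x \<noteq> 0 \<Longrightarrow> norm x \<le> R"
    and deriv: "AE x in lebesgue. ((\<lambda>s. F (x + s *\<^sub>R v)) has_real_derivative G x) (at 0)"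
    and G: "G \<in> borel_measurable lebesgue"
  shows "integral\<^sup>L lebesgue G = 0"
proof -
  define s where "s n x = real (Suc n) * (F (x + inverse (real (Suc n)) *\<^sub>R v) - F x)" for n x
  define w where "w x = L * norm v * indicat_real (cball 0 (R + norm v)) x" for x :: 'a
  have L0: "L \<ge> 0" using lip by (rule lipschitz_on_nonneg)
  have cont: "continuous_on UNIV F" using lip by (rule lipschitz_on_continuous_on)
  have F_borel [measurable]: "F \<in> borel_measurable borel"
    using cont by (rule borel_measurable_continuous_onI)
  have s_borel [measurable]: "s n \<in> borel_measurable borel" for n
    unfolding s_def by measurable
  have F_int: "integrable lborel F"
  proof -
    have bnd: "norm (F x) \<le> norm ((norm (F 0) + L * R) * indicator (cball 0 R) x)" for x
    proof (cases "norm x \<le> R")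
      case True
      have "dist (F x) (F 0) \<le> L * dist x 0" using lip by (rule lipschitz_onD) auto
      also have "\<dots> \<le> L * R" using True L0 by (simp add: mult_left_mono)
      finally have "norm (F x) \<le> norm (F 0) + L * R" by (simp add: dist_norm)
      then show ?thesis using True by simp
    next
      case False
      then have "F x = 0" using supp by blast
      then show ?thesis by simp
    qed
    have "integrable lborel (\<lambda>x::'a. (norm (F 0) + L * R) * indicator (cball 0 R) x)"
      by (intro integrable_mult_right integrable_real_indicator)
         (auto simp: emeasure_lborel_cball_finite[unfolded infinity_ennreal_def])
    then show ?thesis
      by (rule Bochner_Integration.integrable_bound) (use bnd in auto)
  qed
  have s_int: "integral\<^sup>L lebesgue (s n) = 0" for n
  proof -
    define t where "t = inverse (real (Suc n)) *\<^sub>R v"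
    have "integrable lborel (\<lambda>x. F (t + x)) \<and> (\<integral>x. F (t + x) \<partial>lborel) = integral\<^sup>L lborel F"
      using integrable_distr_eq[of "(+) t" lborel borel F] integral_distr[of "(+) t" lborel borel F]
        F_int lborel_distr_plus[of t] by simp
    then have "(\<integral>x. real (Suc n) * (F (t + x) - F x) \<partial>lborel) = 0"
      using F_int by simp
    then have "integral\<^sup>L lborel (s n) = 0"
      unfolding s_def t_def by (simp only: add.commute)
    then show ?thesis by (simp add: integral_completion)
  qed
  \<comment> \<open>the quotients use the step lengths 1 / (n + 1), which are at most 1, whence the ball of radius R + |v| below\<close>
  have s_lim: "(\<lambda>n. s n x) \<longlonglongrightarrow> G x"
    if "((\<lambda>s. F (x + s *\<^sub>R v)) has_real_derivative G x) (at 0)" for x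
  proof -
    have 1: "((\<lambda>h. (F (x + h *\<^sub>R v) - F x) / h) \<longlongrightarrow> G x) (at 0)"
      using that by (simp add: has_field_derivative_iff)
    have "filterlim (\<lambda>n. inverse (real (Suc n))) (at 0) sequentially"
      unfolding filterlim_at using LIMSEQ_inverse_real_of_nat by auto
    from filterlim_compose[OF 1 this] show ?thesis
      by (simp add: s_def field_simps)
  qed
  have s_bound: "norm (s n x) \<le> w x" for n x
  proof -
    define t where "t = inverse (real (Suc n)) *\<^sub>R v"
    have nt: "norm t \<le> norm v"
      unfolding t_def by (simp add: field_simps)
    have "dist (F (x + t)) (F x) \<le> L * dist (x + t) x" using lip by (rule lipschitz_onD) auto
    then have "\<bar>F (x + t) - F x\<bar> \<le> L * norm t" by (simp add: dist_norm)
    then have "real (Suc n) * \<bar>F (x + t) - F x\<bar> \<le> real (Suc n) * (L * norm t)"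
      by (intro mult_left_mono) auto
    also have "\<dots> = L * norm v" unfolding t_def by (simp add: field_simps)
    finally have le: "norm (s n x) \<le> L * norm v"
      by (simp add: s_def t_def abs_mult)
    show ?thesis
    proof (cases "norm x \<le> R + norm v")
      case True then show ?thesis using le by (simp add: w_def)
    next
      case False
      have "norm (x + t) > R" using False nt norm_triangle_ineq4[of "x + t" t] by simp
      then have "F (x + t) = 0" using supp by fastforce
      moreover have "F x = 0" using supp[of x] False norm_ge_zero[of v] by fastforce
      ultimately show ?thesis by (simp add: s_def w_def t_def L0)
    qed
  qed
  have w_int: "integrable lebesgue w"
    unfolding w_def by (intro integrable_mult_right integrable_real_indicator)
      (auto simp: emeasure_lborel_cball_finite[unfolded infinity_ennreal_def])
  have "(\<lambda>n. integral\<^sup>L lebesgue (s n)) \<longlonglongrightarrow> integral\<^sup>L lebesgue G"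
  proof (rule integral_dominated_convergence[where w = w])
    show "AE x in lebesgue. (\<lambda>n. s n x) \<longlonglongrightarrow> G x"
      using deriv by eventually_elim (rule s_lim)
  qed (use G w_int s_bound in \<open>auto intro: measurable_completion\<close>)
  then have "(\<lambda>n::nat. 0::real) \<longlonglongrightarrow> integral\<^sup>L lebesgue G" by (simp only: s_int)
  then show ?thesis by (simp add: LIMSEQ_const_iff)
qed

text \<open>A segment that leaves \<open>K\<close> crosses the frontier, where \<open>F\<close> is zero, so the constant on \<open>K\<close> serves
  globally.\<close>

lemma lipschitz_on_extend_by_0:
  fixes F :: "'a::real_normed_vector \<Rightarrow> real"
  assumes K: "closed K" and lip: "L-lipschitz_on K F"
    and zero: "\<And>x. x \<in> frontier K \<Longrightarrow> F x = 0" "\<And>x. x \<notin> K \<Longrightarrow> F x = 0"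
  shows "L-lipschitz_on UNIV F"
proof (rule lipschitz_onI)
  show L: "0 \<le> L" using lip by (rule lipschitz_on_nonneg)
  have mixed: "\<bar>F x\<bar> \<le> L * dist x y" if "x \<in> K" "y \<notin> K" for x y
  proof -
    have "closed_segment x y \<inter> frontier K \<noteq> {}"
      by (rule connected_Int_frontier) (use that in auto)
    then obtain z where z: "z \<in> closed_segment x y" "z \<in> frontier K" by auto
    then have zK: "z \<in> K" using K by (simp add: frontier_def)
    have "\<bar>F x\<bar> = dist (F x) (F z)" using zero(1)[OF z(2)] by (simp add: dist_real_def)
    also have "\<dots> \<le> L * dist x z" using lip that(1) zK by (rule lipschitz_onD)
    also have "\<dots> \<le> L * dist x y"
      using segment_bound(1)[OF z(1)] L by (intro mult_left_mono) (auto simp: dist_norm norm_minus_commute)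
    finally show ?thesis .
  qed
  fix x y
  show "dist (F x) (F y) \<le> L * dist x y"
  proof (cases "x \<in> K"; cases "y \<in> K")
    assume "x \<in> K" "y \<in> K" then show ?thesis using lip by (blast intro: lipschitz_onD)
  next
    assume "x \<in> K" "y \<notin> K" then show ?thesis using mixed zero(2)[of y] by (simp add: dist_real_def)
  next
    assume "x \<notin> K" "y \<in> K" then show ?thesis
      using mixed[of y x] zero(2)[of x] by (simp add: dist_real_def dist_commute)
  next
    assume "x \<notin> K" "y \<notin> K" then show ?thesis using zero(2) L by simp
  qed
qed

lemma integrable_indicator_mult_compact:
  fixes f :: "'a::euclidean_space \<Rightarrow> real"
  assumes "compact K" "continuous_on K f"
  shows "integrable lebesgue (\<lambda>x. indicator K x * f x)"
proof -
  have *: "integrable lborel (\<lambda>x. indicator K x *\<^sub>R f x)"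
    using assms by (rule borel_integrable_compact)
  then have "(\<lambda>x. indicator K x *\<^sub>R f x) \<in> borel_measurable lborel" by (rule borel_measurable_integrable)
  with * show ?thesis by (simp add: integrable_completion)
qed

section \<open>Directional derivatives and test functions\<close>

lemma dir_deriv_eq:
  assumes "(f has_derivative f') (at x)"
  shows "dir_deriv v f x = f' v"
    and "((\<lambda>s. f (x + s *\<^sub>R v)) has_real_derivative f' v) (at 0)"
proof -
  interpret bounded_linear f' using assms by (rule has_derivative_bounded_linear)
  have "((\<lambda>s. f (x + s *\<^sub>R v)) has_derivative (\<lambda>s. f' (s *\<^sub>R v))) (at 0)"
  proof (rule has_derivative_compose[where f = "\<lambda>s. x + s *\<^sub>R v"])
    show "((\<lambda>s. x + s *\<^sub>R v) has_derivative (\<lambda>s. s *\<^sub>R v)) (at 0)"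
      by (auto intro!: derivative_eq_intros)
  qed (use assms in simp)
  then show *: "((\<lambda>s. f (x + s *\<^sub>R v)) has_real_derivative f' v) (at 0)"
    by (simp add: has_field_derivative_def scaleR mult.commute[of _ "f' v"])
  show "dir_deriv v f x = f' v"
    unfolding dir_deriv_def using * by (rule DERIV_imp_deriv)
qed

lemma dir_deriv_along_line:
  assumes "f differentiable (at (x + r *\<^sub>R v))"
  shows "((\<lambda>s. f (x + s *\<^sub>R v)) has_real_derivative dir_deriv v f (x + r *\<^sub>R v)) (at r)"
proof -
  obtain f' where f': "(f has_derivative f') (at (x + r *\<^sub>R v))"
    using assms by (auto simp: differentiable_def)
  have "((\<lambda>s. f ((x + r *\<^sub>R v) + s *\<^sub>R v)) has_real_derivative dir_deriv v f (x + r *\<^sub>R v)) (at 0)"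
    using dir_deriv_eq[OF f'] by simp
  then have "((\<lambda>s. f (x + s *\<^sub>R v)) has_real_derivative dir_deriv v f (x + r *\<^sub>R v)) (at (0 + r))"
    by (subst DERIV_shift) (simp add: algebra_simps scaleR_add_left)
  then show ?thesis by simp
qed

text \<open>Two applications of the mean value theorem, first along \<open>u\<close> and then along \<open>v\<close>. The left-hand
  side is symmetric in \<open>u\<close> and \<open>v\<close>, which is what makes mixed derivatives commute.\<close>

lemma second_difference_mean_value:
  fixes f :: "real^2 \<Rightarrow> real"
  assumes f: "\<And>y. f differentiable (at y)" and uf: "\<And>y. dir_deriv u f differentiable (at y)"
    and s: "s > 0"
  obtains \<xi> \<eta> where "0 \<le> \<xi>" "\<xi> \<le> s" "0 \<le> \<eta>" "\<eta> \<le> s"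
    "f (x + s *\<^sub>R u + s *\<^sub>R v) - f (x + s *\<^sub>R u) - f (x + s *\<^sub>R v) + f x
       = s\<^sup>2 * dir_deriv v (dir_deriv u f) (x + \<xi> *\<^sub>R u + \<eta> *\<^sub>R v)"
proof -
  define g where "g r = f ((x + s *\<^sub>R v) + r *\<^sub>R u) - f (x + r *\<^sub>R u)" for r
  have "(g has_real_derivative
      dir_deriv u f ((x + s *\<^sub>R v) + r *\<^sub>R u) - dir_deriv u f (x + r *\<^sub>R u)) (at r)" for r
    unfolding g_def by (intro DERIV_diff dir_deriv_along_line f)
  from MVT2[OF s, of g, OF this] obtain \<xi> where \<xi>: "0 < \<xi>" "\<xi> < s"
    "g s - g 0 = (s - 0) * (dir_deriv u f ((x + s *\<^sub>R v) + \<xi> *\<^sub>R u) - dir_deriv u f (x + \<xi> *\<^sub>R u))"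
    by blast
  have "((\<lambda>r. dir_deriv u f ((x + \<xi> *\<^sub>R u) + r *\<^sub>R v)) has_real_derivative
      dir_deriv v (dir_deriv u f) ((x + \<xi> *\<^sub>R u) + r *\<^sub>R v)) (at r)" for r
    by (intro dir_deriv_along_line uf)
  from MVT2[OF s, of "\<lambda>r. dir_deriv u f ((x + \<xi> *\<^sub>R u) + r *\<^sub>R v)", OF this]
  obtain \<eta> where \<eta>: "0 < \<eta>" "\<eta> < s"
    "dir_deriv u f ((x + \<xi> *\<^sub>R u) + s *\<^sub>R v) - dir_deriv u f ((x + \<xi> *\<^sub>R u) + 0 *\<^sub>R v)
       = (s - 0) * dir_deriv v (dir_deriv u f) ((x + \<xi> *\<^sub>R u) + \<eta> *\<^sub>R v)"
    by blast
  have "(x + s *\<^sub>R v) + \<xi> *\<^sub>R u = (x + \<xi> *\<^sub>R u) + s *\<^sub>R v" "(x + s *\<^sub>R v) + s *\<^sub>R u = x + s *\<^sub>R u + s *\<^sub>R v"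
    by (simp_all add: algebra_simps)
  with \<xi>(3) \<eta>(3) have "f (x + s *\<^sub>R u + s *\<^sub>R v) - f (x + s *\<^sub>R u) - f (x + s *\<^sub>R v) + f x
       = s\<^sup>2 * dir_deriv v (dir_deriv u f) (x + \<xi> *\<^sub>R u + \<eta> *\<^sub>R v)"
    by (simp add: g_def power2_eq_square algebra_simps)
  then show ?thesis using \<xi> \<eta> that by (meson less_imp_le)
qed

lemma second_difference_quotient_tendsto:
  fixes f :: "real^2 \<Rightarrow> real"
  assumes f: "\<And>y. f differentiable (at y)" and uf: "\<And>y. dir_deriv u f differentiable (at y)"
    and cont: "isCont (dir_deriv v (dir_deriv u f)) x"
  shows "((\<lambda>s. (f (x + s *\<^sub>R u + s *\<^sub>R v) - f (x + s *\<^sub>R u) - f (x + s *\<^sub>R v) + f x) / s\<^sup>2)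
           \<longlongrightarrow> dir_deriv v (dir_deriv u f) x) (at_right 0)"
proof (rule tendstoI)
  fix e :: real assume "e > 0"
  then obtain d where d: "d > 0" "\<And>y. dist y x < d \<Longrightarrow>
      dist (dir_deriv v (dir_deriv u f) y) (dir_deriv v (dir_deriv u f) x) < e"
    using cont unfolding continuous_at_eps_delta by blast
  have "dist ((f (x + s *\<^sub>R u + s *\<^sub>R v) - f (x + s *\<^sub>R u) - f (x + s *\<^sub>R v) + f x) / s\<^sup>2)
          (dir_deriv v (dir_deriv u f) x) < e"
    if s: "s > 0" "s < d / (norm u + norm v + 1)" for s
  proof -
    obtain \<xi> \<eta> where *: "0 \<le> \<xi>" "\<xi> \<le> s" "0 \<le> \<eta>" "\<eta> \<le> s"
      "f (x + s *\<^sub>R u + s *\<^sub>R v) - f (x + s *\<^sub>R u) - f (x + s *\<^sub>R v) + f x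
       = s\<^sup>2 * dir_deriv v (dir_deriv u f) (x + \<xi> *\<^sub>R u + \<eta> *\<^sub>R v)"
      using second_difference_mean_value[OF f uf s(1)] by metis
    have "dist (x + \<xi> *\<^sub>R u + \<eta> *\<^sub>R v) x \<le> \<xi> * norm u + \<eta> * norm v"
      using norm_triangle_ineq[of "\<xi> *\<^sub>R u" "\<eta> *\<^sub>R v"] *(1,3) by (simp add: dist_norm add.assoc)
    also have "\<dots> \<le> s * norm u + s * norm v"
      using * by (intro add_mono mult_right_mono) auto
    also have "\<dots> < s * (norm u + norm v + 1)" using s by (simp add: algebra_simps)
    also have "\<dots> < d"
      using s(2) by (simp add: pos_less_divide_eq add_nonneg_pos)
    finally show ?thesis using d(2) s(1) by (simp add: *(5))
  qed
  moreover have "d / (norm u + norm v + 1) > 0" using d(1) by (simp add: add_nonneg_pos)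
  ultimately show "\<forall>\<^sub>F s in at_right 0. dist ((f (x + s *\<^sub>R u + s *\<^sub>R v) - f (x + s *\<^sub>R u) - f (x + s *\<^sub>R v) + f x) / s\<^sup>2)
          (dir_deriv v (dir_deriv u f) x) < e"
    unfolding eventually_at_right_field by blast
qed

lemma dir_derivs_commute:
  fixes f :: "real^2 \<Rightarrow> real"
  assumes "\<And>y. f differentiable (at y)"
    and "\<And>y. dir_deriv u f differentiable (at y)" "\<And>y. dir_deriv v f differentiable (at y)"
    and "isCont (dir_deriv v (dir_deriv u f)) x" "isCont (dir_deriv u (dir_deriv v f)) x"
  shows "dir_deriv v (dir_deriv u f) x = dir_deriv u (dir_deriv v f) x"
proof -
  have "((\<lambda>s. (f (x + s *\<^sub>R u + s *\<^sub>R v) - f (x + s *\<^sub>R u) - f (x + s *\<^sub>R v) + f x) / s\<^sup>2)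
           \<longlongrightarrow> dir_deriv v (dir_deriv u f) x) (at_right 0)"
    using assms by (intro second_difference_quotient_tendsto) auto
  moreover have "((\<lambda>s. (f (x + s *\<^sub>R v + s *\<^sub>R u) - f (x + s *\<^sub>R v) - f (x + s *\<^sub>R u) + f x) / s\<^sup>2)
           \<longlongrightarrow> dir_deriv u (dir_deriv v f) x) (at_right 0)"
    using assms by (intro second_difference_quotient_tendsto) auto
  ultimately show ?thesis
    by (intro tendsto_unique[OF trivial_limit_at_right_real]) (simp_all add: algebra_simps)
qed

lemma smooth_partial: "smooth f \<Longrightarrow> smooth (partial j f)"
proof (unfold smooth_def, intro allI)
  fix js x assume "\<forall>js x. foldr partial js f differentiable (at x)"
  then have "foldr partial (js @ [j]) f differentiable (at x)" by blast
  then show "foldr partial js (partial j f) differentiable (at x)" by simp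
qed

lemma smooth_differentiable: "smooth f \<Longrightarrow> f differentiable (at x)"
  by (simp add: smooth_def) (metis foldr_Nil id_apply)

lemma smooth_partials_commute:
  assumes "smooth f" shows "partial i (partial j f) = partial j (partial i f)"
proof
  fix x
  have *: "g differentiable (at y)" if "smooth g" for g y
    using that by (rule smooth_differentiable)
  have 1: "smooth (partial k g)" if "smooth g" for k g
    using that by (rule smooth_partial)
  show "partial i (partial j f) x = partial j (partial i f) x"
    unfolding partial_def
    by (rule dir_derivs_commute)
       (use assms in \<open>auto intro!: * 1 differentiable_imp_continuous_within simp flip: partial_def\<close>)
qed

lemma has_derivative_eq_partials:
  fixes f :: "real^2 \<Rightarrow> real"
  assumes "f differentiable (at x)"
  shows "(f has_derivative (\<lambda>v. v$1 * partial 1 f x + v$2 * partial 2 f x)) (at x)"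
proof -
  obtain f' where f': "(f has_derivative f') (at x)"
    using assms by (auto simp: differentiable_def)
  interpret bounded_linear f' using f' by (rule has_derivative_bounded_linear)
  have "f' v = v$1 * partial 1 f x + v$2 * partial 2 f x" for v
  proof -
    have "v = v$1 *\<^sub>R axis 1 1 + v$2 *\<^sub>R axis 2 1"
      by (simp add: vec_eq_iff forall_2 axis_def)
    then have "f' v = v$1 * f' (axis 1 1) + v$2 * f' (axis 2 1)"
      by (metis add scaleR real_scaleR_def)
    then show ?thesis by (simp add: partial_def dir_deriv_eq(1)[OF f'])
  qed
  then have "f' = (\<lambda>v. v$1 * partial 1 f x + v$2 * partial 2 f x)" by (rule ext)
  with f' show ?thesis by simp
qed

lemma test_function_outside:
  assumes "\<phi> \<in> test_functions \<omega>" "x \<notin> \<omega>" shows "\<phi> x = 0"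
  using assms closure_subset[of "{x. \<phi> x \<noteq> 0}"] by (auto simp: test_functions_def)

text \<open>Differentiation does not enlarge the closed support.\<close>

lemma test_function_partial:
  assumes "\<phi> \<in> test_functions \<omega>" shows "partial j \<phi> \<in> test_functions \<omega>"
proof -
  let ?S = "closure {x. \<phi> x \<noteq> 0}"
  have sub: "{x. partial j \<phi> x \<noteq> 0} \<subseteq> ?S"
  proof (rule ccontr)
    assume "\<not> ?thesis"
    then obtain x where x: "partial j \<phi> x \<noteq> 0" "x \<notin> ?S" by auto
    have "((\<lambda>_. 0) has_derivative (\<lambda>_. 0)) (at x)" by simp
    then have "(\<phi> has_derivative (\<lambda>_. 0)) (at x)"
      by (rule has_derivative_transform_within_open[of _ _ _ _ "- ?S"])
         (use x closure_subset[of "{x. \<phi> x \<noteq> 0}"] in auto)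
    then show False using x(1) by (simp add: partial_def dir_deriv_eq(1))
  qed
  then have "closure {x. partial j \<phi> x \<noteq> 0} \<subseteq> ?S" by (simp add: closure_minimal)
  with assms show ?thesis
    by (auto simp: test_functions_def smooth_partial intro: bounded_subset simp: compact_eq_bounded_closed)
qed

lemma test_function_continuous:
  assumes "\<phi> \<in> test_functions \<omega>" shows "continuous_on UNIV \<phi>"
  using assms by (auto simp: test_functions_def smooth_differentiable differentiable_imp_continuous_within
      continuous_on_eq_continuous_within)

lemma test_function_bounded:
  assumes "\<phi> \<in> test_functions \<omega>"
  obtains B where "B \<ge> 0" "\<And>x. \<bar>\<phi> x\<bar> \<le> B"
proof -
  let ?S = "closure {x. \<phi> x \<noteq> 0}"
  have "compact (\<phi> ` ?S)"
    using assms test_function_continuous[OF assms]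
    by (intro compact_continuous_image) (auto simp: test_functions_def intro: continuous_on_subset)
  then obtain B where B: "\<And>y. y \<in> \<phi> ` ?S \<Longrightarrow> norm y \<le> B"
    using compact_imp_bounded bounded_iff by metis
  have "\<bar>\<phi> x\<bar> \<le> max B 0" for x
    using B[of "\<phi> x"] closure_subset[of "{x. \<phi> x \<noteq> 0}"]
    by (cases "\<phi> x = 0") (auto simp: max_def)
  then show ?thesis using that[of "max B 0"] by simp
qed

lemma test_function_lipschitz:
  assumes "\<phi> \<in> test_functions \<omega>"
  obtains L where "L-lipschitz_on UNIV \<phi>"
proof -
  obtain B1 B2 where B: "B1 \<ge> 0" "B2 \<ge> 0" "\<And>x. \<bar>partial 1 \<phi> x\<bar> \<le> B1" "\<And>x. \<bar>partial 2 \<phi> x\<bar> \<le> B2"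
    using assms test_function_partial test_function_bounded by metis
  have diff: "\<phi> differentiable (at x)" for x
    using assms by (auto simp: test_functions_def smooth_differentiable)
  have "norm (\<phi> x - \<phi> y) \<le> (B1 + B2) * norm (x - y)" for x y
  proof (rule differentiable_bound[where S = UNIV
        and f' = "\<lambda>z v. v$1 * partial 1 \<phi> z + v$2 * partial 2 \<phi> z"])
    fix z
    show "onorm (\<lambda>v::real^2. v$1 * partial 1 \<phi> z + v$2 * partial 2 \<phi> z) \<le> B1 + B2"
    proof (rule onorm_le)
      fix v :: "real^2"
      have "\<bar>v$1\<bar> * \<bar>partial 1 \<phi> z\<bar> \<le> norm v * B1" "\<bar>v$2\<bar> * \<bar>partial 2 \<phi> z\<bar> \<le> norm v * B2"
        using B component_le_norm_cart[of v] by (auto intro!: mult_mono)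
      then show "norm (v$1 * partial 1 \<phi> z + v$2 * partial 2 \<phi> z) \<le> (B1 + B2) * norm v"
        using abs_triangle_ineq[of "v$1 * partial 1 \<phi> z" "v$2 * partial 2 \<phi> z"]
        by (simp add: abs_mult algebra_simps)
    qed
  qed (auto intro!: has_derivative_eq_partials diff)
  then show ?thesis using that[of "B1 + B2"] B by (auto simp: lipschitz_on_def dist_norm)
qed

section \<open>Square-integrable functions\<close>

lemma L2_bounded:
  fixes f :: "real^2 \<Rightarrow> 'a::euclidean_space"
  assumes "f \<in> borel_measurable lebesgue" "AE x in lebesgue. norm (f x) \<le> B"
    and "\<omega> \<in> lmeasurable"
  shows "f \<in> L2 \<omega>"
proof -
  have meas: "f \<in> borel_measurable (lebesgue_on \<omega>)"
    using assms(1) by (rule measurable_restrict_space1)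
  have ae: "AE x in lebesgue_on \<omega>. norm (f x) \<le> B"
    using assms(2,3) by (subst AE_restrict_space_iff) (auto simp: fmeasurableD elim: eventually_mono)
  have "AE x in lebesgue_on \<omega>. norm ((norm (f x))\<^sup>2) \<le> B\<^sup>2"
    using ae by eventually_elim (auto intro: power_mono)
  then have "integrable (lebesgue_on \<omega>) (\<lambda>x. (norm (f x))\<^sup>2)"
    using meas finite_measure_lebesgue_on[OF assms(3)]
    by (intro finite_measure.integrable_const_bound) auto
  with meas show ?thesis by (simp add: L2_def)
qed

lemma integral_lebesgue_on_vanishing:
  fixes f :: "'a::euclidean_space \<Rightarrow> real"
  assumes "\<omega> \<in> sets lebesgue" "\<And>x. x \<notin> \<omega> \<Longrightarrow> f x = 0"
  shows "integral\<^sup>L (lebesgue_on \<omega>) f = integral\<^sup>L lebesgue f"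
proof -
  have "(\<lambda>x. indicator \<omega> x *\<^sub>R f x) = f" using assms(2) by (auto simp: indicator_def intro!: ext)
  then show ?thesis using assms(1) by (simp add: integral_restrict_space)
qed

lemma integrable_L2_test_function:
  fixes f :: "real^2 \<Rightarrow> real"
  assumes f: "f \<in> L2 \<omega>" and \<phi>: "\<phi> \<in> test_functions \<omega>'" and \<omega>: "\<omega> \<in> lmeasurable"
  shows "integrable (lebesgue_on \<omega>) (\<lambda>x. f x * \<phi> x)"
proof -
  obtain B where B: "B \<ge> 0" "\<And>x. \<bar>\<phi> x\<bar> \<le> B" using test_function_bounded[OF \<phi>] by blast
  have fin: "finite_measure (lebesgue_on \<omega>)" using \<omega> by (rule finite_measure_lebesgue_on)
  have "\<phi> \<in> borel_measurable borel"
    using test_function_continuous[OF \<phi>] by (rule borel_measurable_continuous_onI)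
  then have "\<phi> \<in> borel_measurable lebesgue" by (simp add: measurable_completion)
  then have \<phi>m: "\<phi> \<in> borel_measurable (lebesgue_on \<omega>)" by (rule measurable_restrict_space1)
  have "integrable (lebesgue_on \<omega>) (\<lambda>x. (norm (f x))\<^sup>2 + B\<^sup>2)"
    using f fin by (intro Bochner_Integration.integrable_add)
      (auto simp: L2_def intro: finite_measure.integrable_const)
  then show ?thesis
  proof (rule Bochner_Integration.integrable_bound)
    show "(\<lambda>x. f x * \<phi> x) \<in> borel_measurable (lebesgue_on \<omega>)" using f \<phi>m by (auto simp: L2_def)
    have "\<bar>f x * \<phi> x\<bar> \<le> (f x)\<^sup>2 + B\<^sup>2" for x
    proof -
      have "\<bar>f x * \<phi> x\<bar> \<le> \<bar>f x\<bar> * B" using B by (simp add: abs_mult mult_left_mono)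
      also have "\<dots> \<le> (f x)\<^sup>2 + B\<^sup>2"
        using sum_squares_bound[of "\<bar>f x\<bar>" B] B(1) mult_nonneg_nonneg[of "\<bar>f x\<bar>" B]
        unfolding power2_abs by linarith
      finally show ?thesis .
    qed
    then show "AE x in lebesgue_on \<omega>. norm (f x * \<phi> x) \<le> norm ((norm (f x))\<^sup>2 + B\<^sup>2)" by simp
  qed
qed

section \<open>The symmetric curl is divdiv-free\<close>

lemma transpose_sCurl: "transpose (sCurl p x) = sCurl p x"
  by (simp add: sCurl_def sym_part_def transpose_def vec_eq_iff add.commute)

lemma sCurl_entries:
  "sCurl p x $ 1 $ 1 = partial 2 (\<lambda>y. p y $ 1) x"
  "sCurl p x $ 2 $ 2 = - partial 1 (\<lambda>y. p y $ 2) x"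
  "sCurl p x $ 1 $ 2 = (partial 2 (\<lambda>y. p y $ 2) x - partial 1 (\<lambda>y. p y $ 1) x) / 2"
  "sCurl p x $ 2 $ 1 = (partial 2 (\<lambda>y. p y $ 2) x - partial 1 (\<lambda>y. p y $ 1) x) / 2"
  by (simp_all add: sCurl_def sym_part_def Curl_def transpose_def)

text \<open>Writing \<open>D i j\<close> for \<open>\<partial>\<^sub>i p\<^sub>j\<close>, the pairing of \<open>sCurl p\<close> with the Hessian \<open>H\<close> of a test function is
  \<open>D 2 1 * H 1 1 - D 1 1 * H 1 2 + D 2 2 * H 1 2 - D 1 2 * H 2 2\<close>. After one integration by
  parts each difference contains the same third derivative twice.\<close>

lemma weak_divdiv_sCurl:
  assumes p: "weakly_differentiable_L2 \<omega> p" and \<omega>: "\<omega> \<in> lmeasurable"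
  shows "has_weak_divdiv \<omega> (sCurl p) (\<lambda>_. 0)"
  unfolding has_weak_divdiv_def
proof
  fix \<phi> assume \<phi>: "\<phi> \<in> test_functions \<omega>"
  define D where "D i j = partial i (\<lambda>y. p y $ j)" for i j :: 2
  define H where "H i j = partial i (partial j \<phi>)" for i j :: 2
  have smooth: "smooth \<phi>" using \<phi> by (simp add: test_functions_def)
  have H: "H i j \<in> test_functions \<omega>" for i j unfolding H_def by (intro test_function_partial \<phi>)
  have H21: "H 2 1 = H 1 2" unfolding H_def by (rule smooth_partials_commute[OF smooth])
  have third: "partial 2 (H 1 1) = partial 1 (H 1 2)" "partial 1 (H 2 2) = partial 2 (H 1 2)"
    unfolding H_def using smooth_partials_commute smooth_partial smooth by metis+
  have int: "integrable (lebesgue_on \<omega>) (\<lambda>x. D i j x * H k l x)" for i j k l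
    using p H \<omega> by (intro integrable_L2_test_function) (auto simp: D_def weakly_differentiable_L2_def)
  have weak: "(LINT x|lebesgue_on \<omega>. D i j x * H k l x)
      = - (LINT x|lebesgue_on \<omega>. p x $ j * partial i (H k l) x)" for i j k l
    using p H unfolding D_def weakly_differentiable_L2_def has_weak_partial_def by auto
  have "(\<Sum>i\<in>UNIV. \<Sum>j\<in>UNIV. sCurl p x $ i $ j * partial i (partial j \<phi>) x)
      = D 2 1 x * H 1 1 x - D 1 1 x * H 1 2 x + (D 2 2 x * H 1 2 x - D 1 2 x * H 2 2 x)" for x
    using H21 unfolding sum_2 sCurl_entries H_def[symmetric] D_def[symmetric]
    by (simp add: field_simps)
  then have "(LINT x|lebesgue_on \<omega>. (\<Sum>i\<in>UNIV. \<Sum>j\<in>UNIV. sCurl p x $ i $ j * partial i (partial j \<phi>) x))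
      = (LINT x|lebesgue_on \<omega>. D 2 1 x * H 1 1 x) - (LINT x|lebesgue_on \<omega>. D 1 1 x * H 1 2 x)
        + ((LINT x|lebesgue_on \<omega>. D 2 2 x * H 1 2 x) - (LINT x|lebesgue_on \<omega>. D 1 2 x * H 2 2 x))"
    using int by simp
  also have "\<dots> = 0" unfolding weak third by simp
  finally show "(LINT x|lebesgue_on \<omega>. (\<Sum>i\<in>UNIV. \<Sum>j\<in>UNIV. sCurl p x $ i $ j * partial i (partial j \<phi>) x))
      = (LINT x|lebesgue_on \<omega>. 0 * \<phi> x)" by simp
qed

section \<open>Barycentric coordinates of a triangle\<close>

text \<open>Twice the signed area of the triangle \<open>a b c\<close>, negative when \<open>c\<close> is to the right of the
  directed line from \<open>a\<close> to \<open>b\<close>.\<close>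

definition orient :: "real^2 \<Rightarrow> real^2 \<Rightarrow> real^2 \<Rightarrow> real" where
  "orient a b c = rot (b - a) \<bullet> (c - a)"

text \<open>The barycentric coordinate belonging to the \<^emph>\<open>last\<close> vertex \<open>c\<close>, as a quotient of signed areas.
  The coordinates of \<open>a\<close> and \<open>b\<close> arise by rotating the arguments.\<close>

definition bary :: "real^2 \<Rightarrow> real^2 \<Rightarrow> real^2 \<Rightarrow> real^2 \<Rightarrow> real" where
  "bary a b c x = orient a b x / orient a b c"

definition bary_grad :: "real^2 \<Rightarrow> real^2 \<Rightarrow> real^2 \<Rightarrow> real^2" where
  "bary_grad a b c = rot (b - a) /\<^sub>R orient a b c"

lemma rot_nth [simp]: "rot v $ 1 = - v $ 2" "rot v $ 2 = v $ 1"
  by (simp_all add: rot_def)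

lemma inner_2: "x \<bullet> y = x$1 * y$1 + x$2 * y$2" for x y :: "real^2"
  by (simp add: inner_vec_def sum_2)

lemma norm_rot [simp]: "norm (rot v) = norm v"
  by (simp add: norm_eq_sqrt_inner inner_2)

lemma orient_coords: "orient a b c = (b$1 - a$1) * (c$2 - a$2) - (b$2 - a$2) * (c$1 - a$1)"
  by (simp add: orient_def inner_2 algebra_simps)

lemma orient_rotate: "orient b c a = orient a b c"
  by (simp add: orient_coords algebra_simps)

lemma orient_self [simp]: "orient a a c = 0" "orient a b a = 0" "orient a b b = 0"
  by (simp_all add: orient_coords)

lemma bary_affine: "bary a b c x = bary a b c y + bary_grad a b c \<bullet> (x - y)"
proof -
  have "orient a b x = orient a b y + rot (b - a) \<bullet> (x - y)"
    by (simp add: orient_def inner_diff_right)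
  then show ?thesis by (simp add: bary_def bary_grad_def add_divide_distrib inverse_eq_divide)
qed

lemma has_derivative_bary: "(bary a b c has_derivative (\<lambda>v. bary_grad a b c \<bullet> v)) (at x within S)"
proof -
  have *: "bary a b c = (\<lambda>x. bary a b c 0 + bary_grad a b c \<bullet> x)"
  proof
    show "bary a b c x = bary a b c 0 + bary_grad a b c \<bullet> x" for x
      using bary_affine[of a b c x 0] by simp
  qed
  have "((\<lambda>x. k + bary_grad a b c \<bullet> x) has_derivative (\<lambda>v. bary_grad a b c \<bullet> v)) (at x within S)" for k
    by (rule derivative_eq_intros | rule refl | simp)+
  from this[of "bary a b c 0"] show ?thesis unfolding *[symmetric] .
qed

lemma continuous_bary: "continuous_on S (bary a b c)"
  unfolding continuous_on_eq_continuous_within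
  by (intro ballI has_derivative_continuous[OF has_derivative_bary])

context
  fixes a b c :: "real^2"
  assumes nondegenerate: "orient a b c \<noteq> 0"
begin

lemma bary_sum: "bary b c a x + bary c a b x + bary a b c x = 1"
proof -
  have "orient b c x + orient c a x + orient a b x = orient a b c"
    by (simp add: orient_coords algebra_simps)
  then show ?thesis
    using nondegenerate orient_rotate[of a b c] orient_rotate[of b c a]
    by (simp add: bary_def flip: add_divide_distrib)
qed

lemma bary_combination: "bary b c a x *\<^sub>R a + bary c a b x *\<^sub>R b + bary a b c x *\<^sub>R c = x"
proof -
  have "orient b c x * a$i + orient c a x * b$i + orient a b x * c$i = orient a b c * x$i" for i
    using exhaust_2[of i] by (auto simp: orient_coords algebra_simps)
  then have "(orient b c x * a$i + orient c a x * b$i + orient a b x * c$i) / orient a b c = x$i" for i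
    using nondegenerate by simp
  then show ?thesis
    using orient_rotate[of a b c] orient_rotate[of b c a]
    by (simp add: bary_def vec_eq_iff add_divide_distrib)
qed

text \<open>Values at points given as combinations of the vertices, such as vertices, midpoints and points of
  an edge, are computed with this rule.\<close>

lemma bary_unique:
  assumes "u + v + w = 1" "x = u *\<^sub>R a + v *\<^sub>R b + w *\<^sub>R c"
  shows "bary a b c x = w"
proof -
  have u: "u = 1 - v - w" using assms(1) by simp
  have "orient a b x = w * orient a b c"
    unfolding assms(2) u by (simp add: orient_coords algebra_simps)
  then show ?thesis using nondegenerate by (simp add: bary_def)
qed

lemma triangle_distinct: "a \<noteq> b" "b \<noteq> c" "a \<noteq> c"
  using nondegenerate by auto

lemma triangle_affine_independent: "\<not> affine_dependent {a, b, c}"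
proof
  assume "affine_dependent {a, b, c}"
  then obtain U v where U: "sum U {a, b, c} = 0" "v \<in> {a, b, c}" "U v \<noteq> 0"
    "(\<Sum>v\<in>{a, b, c}. U v *\<^sub>R v) = 0"
    by (auto simp: affine_dependent_explicit_finite)
  have s: "U a + (U b + U c) = 0" and z: "U a *\<^sub>R a + (U b *\<^sub>R b + U c *\<^sub>R c) = 0"
    using U(1,4) triangle_distinct by simp_all
  have ua: "U a = - U b - U c" using s by simp
  have "U a * a$i + (U b * b$i + U c * c$i) = 0" for i
    using arg_cong[OF z, of "\<lambda>v. v$i"] by simp
  note z12 = this[of 1] this[of 2]
  have "U b * orient a b c = 0" "U c * orient a b c = 0"
    using z12 unfolding ua orient_coords by algebra+
  then have "U b = 0" "U c = 0" using nondegenerate by auto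
  with ua U(2,3) show False by auto
qed

lemma vertices_triangle: "vertices (convex hull {a, b, c}) = {a, b, c}"
  using extreme_point_of_convex_hull_affine_independent[OF triangle_affine_independent]
  by (auto simp: vertices_def)

lemma triangle_eq: "convex hull {a, b, c} = {x. 0 \<le> bary b c a x \<and> 0 \<le> bary c a b x \<and> 0 \<le> bary a b c x}"
  (is "?K = ?R")
proof
  have n: "orient b c a \<noteq> 0" "orient c a b \<noteq> 0"
    using nondegenerate orient_rotate by metis+
  show "?K \<subseteq> ?R"
  proof
    fix x assume "x \<in> ?K"
    then obtain u v w where *: "0 \<le> u" "0 \<le> v" "0 \<le> w" "u + v + w = 1" "x = u *\<^sub>R a + v *\<^sub>R b + w *\<^sub>R c"
      by (auto simp: convex_hull_3)
    have "bary a b c x = w" using * by (intro bary_unique) auto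
    moreover have "orient b c x = u * orient b c a" "orient c a x = v * orient c a b"
    proof -
      have w: "w = 1 - u - v" using * by simp
      show "orient b c x = u * orient b c a" "orient c a x = v * orient c a b"
        unfolding *(5) w by (simp_all add: orient_coords algebra_simps)
    qed
    then have "bary b c a x = u" "bary c a b x = v" using n by (simp_all add: bary_def)
    ultimately show "x \<in> ?R" using * by simp
  qed
  show "?R \<subseteq> ?K"
  proof
    fix x assume "x \<in> ?R"
    then show "x \<in> ?K"
      using bary_sum[of x] bary_combination[of x, symmetric] unfolding convex_hull_3 by blast
  qed
qed

lemma interior_triangle:
  assumes "0 < bary b c a x" "0 < bary c a b x" "0 < bary a b c x"
  shows "x \<in> interior (convex hull {a, b, c})"
proof (rule interiorI)
  show "open {x. 0 < bary b c a x \<and> 0 < bary c a b x \<and> 0 < bary a b c x}"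
    by (intro open_Collect_conj open_Collect_less continuous_bary continuous_on_const)
qed (use assms in \<open>auto simp: triangle_eq\<close>)

lemma frontier_triangle_bary:
  assumes "x \<in> frontier (convex hull {a, b, c})"
  shows "bary b c a x = 0 \<or> bary c a b x = 0 \<or> bary a b c x = 0"
proof (rule ccontr)
  assume *: "\<not> ?thesis"
  have "closed (convex hull {a, b, c})"
    by (simp add: compact_convex_hull compact_imp_closed)
  then have "x \<in> convex hull {a, b, c}" "x \<notin> interior (convex hull {a, b, c})"
    using assms by (auto simp: frontier_def)
  with * interior_triangle[of x] show False by (auto simp: triangle_eq)
qed

lemma opposite_edge:
  assumes "x \<in> convex hull {a, b, c}" "bary a b c x = 0"
  shows "x \<in> closed_segment a b"
proof -
  have "x = bary b c a x *\<^sub>R a + bary c a b x *\<^sub>R b" "bary b c a x = 1 - bary c a b x"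
    using bary_combination[of x] bary_sum[of x] assms(2) by auto
  then show ?thesis using assms by (auto simp: triangle_eq closed_segment_def)
qed

lemma bary_le_1: "x \<in> convex hull {a, b, c} \<Longrightarrow> bary a b c x \<le> 1"
  using bary_sum[of x] by (auto simp: triangle_eq)

text \<open>Along a diameter of an inscribed disc in the gradient direction the coordinate grows by
  \<open>2 r\<close> times the norm of the gradient, while it stays within \<open>[0, 1]\<close>.\<close>

lemma norm_bary_grad_le:
  assumes "cball x r \<subseteq> convex hull {a, b, c}" "r \<ge> 0"
  shows "norm (bary_grad a b c) * (2 * r) \<le> 1"
proof (cases "bary_grad a b c = 0")
  case False
  define d where "d = (r / norm (bary_grad a b c)) *\<^sub>R bary_grad a b c"
  have "norm d = r" using False assms(2) by (simp add: d_def)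
  then have "x + d \<in> convex hull {a, b, c}" "x - d \<in> convex hull {a, b, c}"
    using assms(1) by (auto simp: subset_iff dist_norm)
  then have range: "bary a b c (x + d) \<le> 1 \<and> bary a b c (x - d) \<ge> 0"
    using bary_le_1 by (auto simp: triangle_eq)
  have "bary_grad a b c \<bullet> d = norm (bary_grad a b c) * r"
    using False by (simp add: d_def dot_square_norm power2_eq_square)
  moreover have "(x + d) - (x - d) = 2 *\<^sub>R d" by (simp add: scaleR_2)
  ultimately have "bary a b c (x + d) = bary a b c (x - d) + 2 * (norm (bary_grad a b c) * r)"
    using bary_affine[of a b c "x + d" "x - d"] by (simp only: inner_scaleR_right)
  with range show ?thesis by simp
qed simp

lemma norm_bary_grad_inball: "norm (bary_grad a b c) * inball_diameter (convex hull {a, b, c}) \<le> 1"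
proof (cases "bary_grad a b c = 0")
  case False
  let ?S = "{2 * r | r. r \<ge> 0 \<and> (\<exists>x. cball x r \<subseteq> convex hull {a, b, c})}"
  have "Sup ?S \<le> 1 / norm (bary_grad a b c)"
  proof (rule cSup_least)
    have "cball a 0 \<subseteq> convex hull {a, b, c}" by (simp add: hull_inc)
    then show "?S \<noteq> {}" by blast
    show "s \<le> 1 / norm (bary_grad a b c)" if "s \<in> ?S" for s
      using that norm_bary_grad_le False by (auto simp: pos_le_divide_eq mult.commute)
  qed
  then show ?thesis using False by (simp add: inball_diameter_def pos_le_divide_eq mult.commute)
qed simp

end

lemma barycentric_triangle:
  assumes o: "orient a b c \<noteq> 0"
  shows "barycentric {a, b, c} x c = bary a b c x"
proof -
  have o': "orient b c a \<noteq> 0" "orient c a b \<noteq> 0"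
    using o orient_rotate by metis+
  note bary_sum = bary_sum[OF o] and bary_combination = bary_combination[OF o]
    and triangle_distinct = triangle_distinct[OF o]
  define u where "u v = (if v = a then bary b c a x else if v = b then bary c a b x
     else if v = c then bary a b c x else 0)" for v
  have "barycentric {a, b, c} x = u"
    unfolding barycentric_def
  proof (rule the_equality)
    show "(\<forall>v. v \<notin> {a, b, c} \<longrightarrow> u v = 0) \<and> sum u {a, b, c} = 1 \<and> (\<Sum>v\<in>{a, b, c}. u v *\<^sub>R v) = x"
      using triangle_distinct bary_sum[of x] bary_combination[of x]
      by (simp add: u_def add.assoc)
  next
    fix w assume w: "(\<forall>v. v \<notin> {a, b, c} \<longrightarrow> w v = 0) \<and> sum w {a, b, c} = 1 \<and> (\<Sum>v\<in>{a, b, c}. w v *\<^sub>R v) = x"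
    have s: "w a + (w b + w c) = 1" "w a *\<^sub>R a + (w b *\<^sub>R b + w c *\<^sub>R c) = x"
      using w triangle_distinct by simp_all
    have "w c = bary a b c x"
      by (rule bary_unique[OF o, symmetric, of "w a" "w b"]) (use s in \<open>simp_all add: add.assoc\<close>)
    moreover have "w a = bary b c a x"
      by (rule bary_unique[OF o'(1), symmetric, of "w b" "w c"]) (use s in \<open>simp_all add: add_ac\<close>)
    moreover have "w b = bary c a b x"
      by (rule bary_unique[OF o'(2), symmetric, of "w c" "w a"]) (use s in \<open>simp_all add: add_ac\<close>)
    ultimately show "w = u" using w by (auto simp: u_def)
  qed
  then show ?thesis using triangle_distinct by (simp add: u_def)
qed

lemma inball_diameter_nonneg:
  assumes "bounded K" "K \<noteq> {}" shows "inball_diameter K \<ge> 0"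
proof -
  let ?S = "{2 * r | r. r \<ge> 0 \<and> (\<exists>x. cball x r \<subseteq> K)}"
  obtain z where "z \<in> K" using assms by auto
  then have "cball z 0 \<subseteq> K" by simp
  then have "0 \<in> ?S" by force
  moreover have "bdd_above ?S"
  proof (rule bdd_aboveI)
    fix s assume "s \<in> ?S"
    then obtain r x where "s = 2 * r" "r \<ge> 0" "cball x r \<subseteq> K" by auto
    then show "s \<le> diameter K"
      using diameter_subset[of "cball x r" K] assms(1) by (simp add: diameter_cball)
  qed
  ultimately show ?thesis unfolding inball_diameter_def by (rule cSup_upper)
qed

text \<open>Any two distinct vertices of a triangle can be listed first, and then a third vertex completes
  them to a nondegenerate triple.\<close>

lemma two_simplex_triangle:
  assumes "2 simplex K" "a extreme_point_of K" "b extreme_point_of K" "a \<noteq> b"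
  obtains c where "K = convex hull {a, b, c}" "orient a b c \<noteq> 0"
proof -
  obtain C where C: "finite C" "\<not> affine_dependent C" "int (card C) = 2 + 1" "K = convex hull C"
    using assms(1) by (auto simp: simplex)
  have ab: "a \<in> C" "b \<in> C"
    using assms(2,3) C(4) extreme_point_of_convex_hull by blast+
  have "card (C - {a, b}) = 1" using C ab assms(4) by (simp add: card_Diff_subset)
  then obtain c where "C - {a, b} = {c}" by (auto simp: card_1_singleton_iff)
  then have Cabc: "C = {a, b, c}" "c \<noteq> a" "c \<noteq> b" using ab by auto
  have "orient a b c \<noteq> 0"
  proof
    assume 0: "orient a b c = 0"
    have o: "(b$1 - a$1) * (c$2 - a$2) = (b$2 - a$2) * (c$1 - a$1)"
      using 0 by (simp add: orient_coords)
    have "c - a = (((c - a) \<bullet> (b - a)) / ((b - a) \<bullet> (b - a))) *\<^sub>R (b - a)"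
    proof -
      have nz: "(b - a) \<bullet> (b - a) \<noteq> 0" using assms(4) by simp
      have "((c - a) \<bullet> (b - a)) * (b - a)$1 = ((b - a) \<bullet> (b - a)) * (c - a)$1"
        "((c - a) \<bullet> (b - a)) * (b - a)$2 = ((b - a) \<bullet> (b - a)) * (c - a)$2"
        using o unfolding inner_2 vector_minus_component by algebra+
      then have "(c - a)$i = ((c - a) \<bullet> (b - a)) * (b - a)$i / ((b - a) \<bullet> (b - a))" for i
        using exhaust_2[of i] nz by (metis nonzero_mult_div_cancel_left)
      then show ?thesis by (simp add: vec_eq_iff)
    qed
    then obtain t where "c - a = t *\<^sub>R (b - a)" by blast
    then have "c = (1 - t) *\<^sub>R a + t *\<^sub>R b" by (simp add: algebra_simps)
    then have "c \<in> affine hull {a, b}"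
      unfolding affine_hull_2 by (intro CollectI exI[of _ "1 - t"] exI[of _ t]) simp
    moreover have "{a, b, c} - {c} = {a, b}" using Cabc by auto
    ultimately have "affine_dependent {a, b, c}" unfolding affine_dependent_def
      by (metis insertCI)
    then show False using C(2) Cabc by simp
  qed
  then show ?thesis using that C(4) Cabc by blast
qed

section \<open>Polynomial tensor fields\<close>

lemma coordinate_polynomial: "real_polynomial_function (\<lambda>x. x $ i)"
  by (rule real_polynomial_function.intros(1)) (rule bounded_linear_vec_nth)

lemma Pk_polynomial:
  assumes "f \<in> Pk k" shows "real_polynomial_function f"
proof -
  obtain c where f: "f = (\<lambda>x. \<Sum>i\<le>k. \<Sum>j\<le>k - i. c i j * (x$1) ^ i * (x$2) ^ j)"
    using assms by (auto simp: Pk_def)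
  show ?thesis
    unfolding f
    by (intro real_polynomial_function_sum real_polynomial_function.intros(4) real_polynomial_function.intros(2)
        real_polynomial_function_power coordinate_polynomial finite_atMost)
qed

lemma RT_polynomial:
  assumes "\<phi> \<in> RT k" shows "real_polynomial_function (\<lambda>x. \<phi> x $ i)"
proof -
  obtain q r where \<phi>: "\<phi> = (\<lambda>x. q x + r x *\<^sub>R x)" "(\<lambda>x. q x $ i) \<in> Pk k" "r \<in> Pk k"
    using assms by (auto simp: RT_def)
  show ?thesis
    unfolding \<phi>(1) vector_add_component vector_scaleR_component real_scaleR_def
    by (intro real_polynomial_function.intros(3) real_polynomial_function.intros(4) coordinate_polynomial
        Pk_polynomial[OF \<phi>(2)] Pk_polynomial[OF \<phi>(3)])
qed

lemma X_local_polynomial: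
  assumes "Q \<in> X_local" shows "real_polynomial_function (\<lambda>x. Q x $ i $ j)"
proof -
  obtain m a \<phi> \<psi> where Q: "Q = (\<lambda>x. sym_part (\<Sum>l<(m::nat). a l *\<^sub>R outer (\<phi> l x) (\<psi> l x)))"
    and RT: "\<And>l. l < m \<Longrightarrow> \<phi> l \<in> RT 0 \<and> \<psi> l \<in> RT 1"
    using assms by (auto simp: X_local_def tensor_span_def)
  have "(\<lambda>x. Q x $ i $ j) = (\<lambda>x. (1/2) * ((\<Sum>l<m. a l * (\<phi> l x $ i * \<psi> l x $ j))
      + (\<Sum>l<m. a l * (\<phi> l x $ j * \<psi> l x $ i))))"
    by (simp add: Q sym_part_def outer_def transpose_def sum_component)
  moreover have "real_polynomial_function \<dots>"
    using RT by (intro real_polynomial_function_sum real_polynomial_function.intros(2-4))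
      (auto intro!: RT_polynomial)
  ultimately show ?thesis by simp
qed

text \<open>On every line through a point of \<open>U\<close> the difference is a polynomial in one variable with
  infinitely many zeros.\<close>

lemma polynomial_eq_if_eq_on_open:
  fixes f g :: "'a::euclidean_space \<Rightarrow> real"
  assumes "real_polynomial_function f" "real_polynomial_function g"
    and U: "open U" "U \<noteq> {}" and eq: "\<And>x. x \<in> U \<Longrightarrow> f x = g x"
  shows "f = g"
proof
  fix y
  obtain x0 where x0: "x0 \<in> U" using U by auto
  define \<gamma> where "\<gamma> t = x0 + t *\<^sub>R (y - x0)" for t :: real
  have \<gamma>: "polynomial_function \<gamma>"
    unfolding \<gamma>_def
    by (intro polynomial_function_add polynomial_function_const
        polynomial_function_bounded_linear bounded_linear_scaleR_left)
  have "real_polynomial_function (\<lambda>x. f x - g x)"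
    using assms by (intro real_polynomial_function_diff)
  then have "real_polynomial_function ((\<lambda>x. f x - g x) \<circ> \<gamma>)"
    by (rule real_polynomial_function_compose[OF \<gamma>])
  then obtain c n where c: "\<And>t. f (\<gamma> t) - g (\<gamma> t) = (\<Sum>i\<le>n. c i * t ^ i)"
    by (auto simp: real_polynomial_function_iff_sum o_def fun_eq_iff)
  have "open (\<gamma> -` U)"
    using U(1) by (intro open_vimage) (auto simp: \<gamma>_def intro!: continuous_intros)
  moreover have "0 \<in> \<gamma> -` U" using x0 by (simp add: \<gamma>_def)
  ultimately have "infinite (\<gamma> -` U)" using finite_imp_not_open by auto
  moreover have "\<gamma> -` U \<subseteq> {t. (\<Sum>i\<le>n. c i * t ^ i) = 0}"
    using eq by (auto simp flip: c)
  ultimately have "infinite {t. (\<Sum>i\<le>n. c i * t ^ i) = 0}" using finite_subset by blast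
  then have "\<forall>i\<le>n. c i = 0" using polyfun_finite_roots[of c n] by blast
  then have "f (\<gamma> 1) - g (\<gamma> 1) = 0" unfolding c by simp
  then show "f y = g y" by (simp add: \<gamma>_def)
qed

text \<open>An open set on which two continuous functions differ has positive measure unless it is empty, so
  they agree on the interior of \<open>K\<close>, and as polynomials everywhere.\<close>

lemma X_local_eq_if_AE_eq:
  assumes Q: "Q \<in> X_local" "Q' \<in> X_local" and K: "interior K \<noteq> {}" "K \<in> sets lebesgue"
    and ae: "AE x in lebesgue_on K. Q x = Q' x"
  shows "Q = Q'"
proof -
  have cont: "continuous_on UNIV (\<lambda>x. Q x $ i $ j)" if "Q \<in> X_local" for Q i j
    using X_local_polynomial[OF that]
    by (meson continuous_at_imp_continuous_on continuous_real_polymonial_function)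
  have "(\<lambda>x. Q x $ i $ j) = (\<lambda>x. Q' x $ i $ j)" for i j
  proof (rule polynomial_eq_if_eq_on_open[OF X_local_polynomial[OF Q(1)] X_local_polynomial[OF Q(2)]
        open_interior K(1)])
    let ?B = "interior K \<inter> {x. Q x $ i $ j \<noteq> Q' x $ i $ j}"
    have "open ?B" by (intro open_Int open_interior open_Collect_neq cont Q)
    moreover have "negligible ?B"
    proof -
      have "AE x in lebesgue. x \<in> K \<longrightarrow> Q x = Q' x"
        using ae K(2) by (simp add: AE_restrict_space_iff)
      then have "AE x in lebesgue. x \<notin> ?B"
        by eventually_elim (use interior_subset[of K] in auto)
      moreover have "?B \<in> sets lebesgue" using \<open>open ?B\<close> by (simp add: borel_open)
      ultimately show ?thesis by (simp add: AE_iff_null_sets negligible_iff_null_sets)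
    qed
    ultimately have "?B = {}" using open_not_negligible by blast
    then show "Q x $ i $ j = Q' x $ i $ j" if "x \<in> interior K" for x using that by blast
  qed
  then show ?thesis by (auto simp: fun_eq_iff vec_eq_iff)
qed

lemma const_in_RT0: "(\<lambda>_. u) \<in> RT 0"
proof -
  have "(\<lambda>_. c) \<in> Pk 0" for c :: real
    unfolding Pk_def by (intro CollectI exI[of _ "\<lambda>_ _. c"]) simp
  then show ?thesis
    unfolding RT_def by (intro CollectI exI[of _ "\<lambda>_. u"] exI[of _ "\<lambda>_. 0"]) simp
qed

lemma affine_in_RT1:
  assumes "\<And>i. \<exists>c g. \<forall>x. w x $ i = c + g \<bullet> x"
  shows "w \<in> RT 1"
proof -
  have affine: "(\<lambda>x. c + g \<bullet> x) \<in> Pk 1" for c :: real and g :: "real^2"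
    unfolding Pk_def
    by (intro CollectI exI[of _ "\<lambda>i j. if i = 0 \<and> j = 0 then c else if i = 0 then g$2 else g$1"])
       (auto simp: inner_2)
  have "(\<lambda>x. w x $ i) \<in> Pk 1" for i
  proof -
    obtain c g where "\<forall>x. w x $ i = c + g \<bullet> x" using assms by blast
    then have "(\<lambda>x. w x $ i) = (\<lambda>x. c + g \<bullet> x)" by auto
    then show ?thesis using affine by simp
  qed
  moreover have "(\<lambda>_. 0) \<in> Pk 1" using affine[of 0 0] by simp
  ultimately show ?thesis
    unfolding RT_def by (intro CollectI exI[of _ w] exI[of _ "\<lambda>_. 0"]) simp
qed

text \<open>A constant vector is in the lowest-order space, so each outer product is a generator of the tensor
  span, and taking the symmetric part commutes with the sum.\<close>

lemma sum_sym_outer_in_X_local: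
  assumes "finite S" "\<And>e. e \<in> S \<Longrightarrow> w e \<in> RT 1"
  shows "(\<lambda>x. \<Sum>e\<in>S. c e *\<^sub>R sym_part (outer (n e) (w e x))) \<in> X_local"
proof -
  obtain f where f: "bij_betw f {..<card S} S"
    using ex_bij_betw_nat_finite[OF assms(1)] by (auto simp: lessThan_atLeast0)
  let ?Q = "\<lambda>x. \<Sum>l<card S. c (f l) *\<^sub>R outer (n (f l)) (w (f l) x)"
  have "?Q \<in> tensor_span (RT 0) (RT 1)"
    unfolding tensor_span_def
    by (intro CollectI exI[of _ "card S"] exI[of _ "\<lambda>l. c (f l)"] exI[of _ "\<lambda>l _. n (f l)"]
        exI[of _ "\<lambda>l. w (f l)"])
       (use assms(2) f const_in_RT0 in \<open>auto simp: bij_betw_def\<close>)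
  then have "(\<lambda>x. sym_part (?Q x)) \<in> X_local"
    unfolding X_local_def by (intro CollectI exI[of _ ?Q]) simp
  moreover have "sym_part (?Q x) = (\<Sum>e\<in>S. c e *\<^sub>R sym_part (outer (n e) (w e x)))" for x
  proof -
    have "?Q x = (\<Sum>e\<in>S. c e *\<^sub>R outer (n e) (w e x))"
      by (rule sum.reindex_bij_betw[OF f])
    then show ?thesis
      by (simp add: sym_part_def transpose_def vec_eq_iff sum_component sum_distrib_left
          sum.distrib[symmetric] algebra_simps)
  qed
  ultimately show ?thesis by simp
qed

lemma norm_sym_outer_le: "norm (sym_part (outer u v)) \<le> norm u * norm v"
proof -
  have nv: "(norm x)\<^sup>2 = (x$1)\<^sup>2 + (x$2)\<^sup>2" for x :: "real^2"
    unfolding power2_norm_eq_inner by (simp add: inner_2 power2_eq_square)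
  have nm: "(norm M)\<^sup>2 = (M$1$1)\<^sup>2 + (M$1$2)\<^sup>2 + ((M$2$1)\<^sup>2 + (M$2$2)\<^sup>2)" for M :: "real^2^2"
    unfolding power2_norm_eq_inner by (simp add: inner_vec_def sum_2 power2_eq_square)
  have "(norm (sym_part (outer u v)))\<^sup>2 + (u$1 * v$2 - u$2 * v$1)\<^sup>2 / 2 = (norm u * norm v)\<^sup>2"
    unfolding power_mult_distrib nv nm
    by (simp add: sym_part_def outer_def transpose_def power2_eq_square field_simps)
  then have "(norm (sym_part (outer u v)))\<^sup>2 \<le> (norm u * norm v)\<^sup>2"
    by (smt (verit) zero_le_power2 divide_nonneg_pos)
  then show ?thesis by (rule power2_le_imp_le) simp
qed

section \<open>Edge traces of symmetrised rank-one tensors\<close>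

text \<open>The quantity \<open>n \<bullet> div Q + \<partial>\<^sub>t (n \<bullet> Q t)\<close> with \<open>n = rot t\<close> as a functional of the Frechet
  derivative \<open>D\<close> of \<open>Q\<close>. In this form it is visibly linear.\<close>

definition qn_form :: "real^2 \<Rightarrow> (real^2 \<Rightarrow> real^2^2) \<Rightarrow> real" where
  "qn_form t D = rot t \<bullet> (\<chi> i. \<Sum>j\<in>UNIV. D (axis j 1) $ i $ j) + rot t \<bullet> (D t *v t)"

lemma qn_form_sum:
  assumes "finite S"
  shows "qn_form t (\<lambda>v. \<Sum>e\<in>S. c e *\<^sub>R D e v) = (\<Sum>e\<in>S. c e * qn_form t (D e))"
  using assms
  by (induction S rule: finite_induct)
     (simp_all add: qn_form_def inner_2 sum_2 matrix_vector_mult_def algebra_simps)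

lemma qn_form_of_derivative:
  assumes "(Q has_derivative D) (at x)"
  shows "rot t \<bullet> div_rows Q x + dir_deriv t (\<lambda>y. rot t \<bullet> (Q y *v t)) x = qn_form t D"
proof -
  have "partial j (\<lambda>y. Q y $ i $ j) x = D (axis j 1) $ i $ j" for i j
    unfolding partial_def
    by (rule dir_deriv_eq(1)) (intro bounded_linear.has_derivative[OF bounded_linear_vec_nth] assms)
  moreover have "dir_deriv t (\<lambda>y. rot t \<bullet> (Q y *v t)) x = rot t \<bullet> (D t *v t)"
  proof (rule dir_deriv_eq(1)[where f' = "\<lambda>v. rot t \<bullet> (D v *v t)"])
    have "linear (\<lambda>M::real^2^2. rot t \<bullet> (M *v t))"
      by (rule linearI) (simp_all add: matrix_vector_mult_add_rdistrib inner_add_right scaleR_matrix_vector_assoc[symmetric])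
    then have "bounded_linear (\<lambda>M::real^2^2. rot t \<bullet> (M *v t))"
      by (simp add: linear_conv_bounded_linear)
    then show "((\<lambda>y. rot t \<bullet> (Q y *v t)) has_derivative (\<lambda>v. rot t \<bullet> (D v *v t))) (at x)"
      using assms by (rule bounded_linear.has_derivative)
  qed
  ultimately show ?thesis by (simp add: qn_form_def div_rows_def)
qed

text \<open>Here \<open>rot t \<bullet> (- rot g) = - (g \<bullet> t)\<close>: a normal component of a rotated gradient is a tangential
  derivative.\<close>

lemma nn_sym_outer:
  "rot t \<bullet> (sym_part (outer m (- rot g)) *v rot t) = - (rot t \<bullet> m) * (g \<bullet> t)"
  by (simp add: inner_2 sym_part_def outer_def transpose_def matrix_vector_mult_def sum_2 field_simps)

text \<open>With \<open>g\<close> and \<open>k\<close> the gradients of two affine functions, the tensor is the derivative of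
  \<open>sym (m (- rot (\<nabla>b))\<^sup>T)\<close> for their product \<open>b\<close>, and the right-hand side is
  \<open>- (m \<bullet> t) \<partial>\<^sub>t\<partial>\<^sub>t b\<close>.\<close>

lemma qn_form_sym_outer:
  assumes "norm t = 1"
  shows "qn_form t (\<lambda>v. sym_part (outer m (- rot ((g \<bullet> v) *\<^sub>R k + (k \<bullet> v) *\<^sub>R g))))
    = - 2 * (m \<bullet> t) * (g \<bullet> t) * (k \<bullet> t)"
proof -
  define D where "D v = sym_part (outer m (- rot ((g \<bullet> v) *\<^sub>R k + (k \<bullet> v) *\<^sub>R g)))" for v
  have "(t$1)\<^sup>2 + (t$2)\<^sup>2 = 1"
    using assms by (simp add: norm_eq_1 inner_2 power2_eq_square)
  \<comment> \<open>multiplying the divergence part by |t|^2 = 1 makes both sides homogeneous of degree three in t, and the claim a polynomial identity\<close>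
  then have "qn_form t D = ((t$1)\<^sup>2 + (t$2)\<^sup>2) * (rot t \<bullet> (\<chi> i. \<Sum>j\<in>UNIV. D (axis j 1) $ i $ j))
      + rot t \<bullet> (D t *v t)"
    by (simp add: qn_form_def)
  also have "\<dots> = - 2 * (m \<bullet> t) * (g \<bullet> t) * (k \<bullet> t)"
    by (simp add: D_def inner_2 sym_part_def outer_def transpose_def matrix_vector_mult_def sum_2
        axis_def power2_eq_square) (simp add: field_simps)
  finally show ?thesis by (simp add: D_def[abs_def])
qed

section \<open>Elements at the boundary\<close>

text \<open>Near a boundary point the domain is the region above a graph, so points just below it are not in
  the closure.\<close>

lemma lipschitz_domain_frontier:
  assumes "lipschitz_domain \<Omega>" "x \<in> frontier \<Omega>"
  shows "x \<notin> interior (closure \<Omega>)"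
proof
  assume "x \<in> interior (closure \<Omega>)"
  then obtain d where d: "d > 0" "ball x d \<subseteq> closure \<Omega>"
    by (meson interior_subset mem_interior open_contains_ball open_interior subset_trans)
  obtain u r L and g :: "real \<Rightarrow> real" where u: "norm u = 1" "r > 0" and g: "L-lipschitz_on UNIV g"
    and eq: "\<Omega> \<inter> ball x r = {y \<in> ball x r. g (y \<bullet> u) < y \<bullet> rot u}"
  proof -
    from assms(1) have "\<forall>x\<in>frontier \<Omega>. \<exists>u r L. \<exists>g::real \<Rightarrow> real. norm u = 1 \<and> r > 0 \<and> L-lipschitz_on UNIV g \<and>
        \<Omega> \<inter> ball x r = {y \<in> ball x r. g (y \<bullet> u) < y \<bullet> rot u}"
      unfolding lipschitz_domain_def by (elim conjE)
    from bspec[OF this assms(2)] show ?thesis by (elim exE conjE) (rule that)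
  qed
  have "open \<Omega>" using assms(1) by (simp add: lipschitz_domain_def)
  then have "x \<notin> \<Omega>" using assms(2) by (simp add: frontier_def interior_open)
  then have gx: "x \<bullet> rot u \<le> g (x \<bullet> u)" using eq u(2) by force
  \<comment> \<open>half the minimum keeps y inside both balls\<close>
  define \<epsilon> where "\<epsilon> = min d r / 2"
  define y where "y = x - \<epsilon> *\<^sub>R rot u"
  have \<epsilon>: "\<epsilon> > 0" "\<epsilon> < d" "\<epsilon> < r" using d u by (auto simp: \<epsilon>_def)
  have "dist x y = \<epsilon>" using u \<epsilon> by (simp add: y_def dist_norm)
  then have y: "y \<in> closure \<Omega>" "y \<in> ball x r" using d(2) \<epsilon> by auto
  have "rot u \<bullet> u = 0" "rot u \<bullet> rot u = 1" 
    using u(1) by (simp_all add: inner_2 norm_eq_1 mult.commute)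
  then have "y \<bullet> u = x \<bullet> u" "y \<bullet> rot u = x \<bullet> rot u - \<epsilon>"
    by (simp_all add: y_def inner_diff_left)
  then have yg: "y \<bullet> rot u < g (y \<bullet> u)" using gx \<epsilon> by simp
  let ?U = "ball x r \<inter> {z. z \<bullet> rot u < g (z \<bullet> u)}"
  have "continuous_on UNIV g" using g by (rule lipschitz_on_continuous_on)
  then have "continuous_on UNIV (\<lambda>z. g (z \<bullet> u))"
    by (rule continuous_on_compose2) (auto intro!: continuous_intros)
  then have "open ?U"
    by (intro open_Int open_ball open_Collect_less) (auto intro!: continuous_intros)
  moreover have "?U \<inter> \<Omega> = {}" using eq by force
  ultimately have "?U \<inter> closure \<Omega> = {}" by (simp only: open_Int_closure_eq_empty)
  with y yg show False by blast
qed

text \<open>A face of a convex set that meets its relative interior is the whole set. Applied to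
  \<open>K \<inter> K'\<close> as a face of \<open>K\<close> this gives \<open>K \<subseteq> K'\<close>, and then, as a face of \<open>K'\<close>, equality.\<close>

lemma triangulation_interior_disjoint:
  assumes "triangulation T" "K \<in> T" "K' \<in> T" "x \<in> interior K" "x \<in> K'"
  shows "K = K'"
proof -
  have face: "(K \<inter> K') face_of K" "(K \<inter> K') face_of K'"
    using assms(1-3) unfolding triangulation_def by (metis, metis inf_commute)
  have int: "interior K \<noteq> {}" using assms(4) by auto
  have "K \<subseteq> K \<inter> K'"
    using face(1)
  proof (rule subset_of_face_of)
    show "K \<inter> K' \<inter> rel_interior K \<noteq> {}"
      using assms(4,5) rel_interior_nonempty_interior[OF int] interior_subset[of K] by auto
  qed simp
  then have x: "x \<in> interior K'" using assms(4) interior_mono[of K K'] by auto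
  have "K' \<subseteq> K \<inter> K'"
    using face(2)
  proof (rule subset_of_face_of)
    have "rel_interior K' = interior K'" using x by (intro rel_interior_nonempty_interior) auto
    then show "K \<inter> K' \<inter> rel_interior K' \<noteq> {}"
      using x assms(4,5) interior_subset[of K] by auto
  qed simp
  with \<open>K \<subseteq> K \<inter> K'\<close> show ?thesis by auto
qed

locale triangulated_domain =
  fixes \<Omega> :: "(real^2) set" and T :: "(real^2) set set"
  assumes lipschitz: "lipschitz_domain \<Omega>" and triangulation: "conforming_triangulation \<Omega> T"
begin

abbreviation "\<E> \<equiv> boundary_edges \<Omega> T"

lemma two_simplex: "K \<in> T \<Longrightarrow> 2 simplex K"
  using triangulation by (auto simp: conforming_triangulation_def)

lemma elements_interior_disjoint:
  "K \<in> T \<Longrightarrow> K' \<in> T \<Longrightarrow> x \<in> interior K \<Longrightarrow> x \<in> K' \<Longrightarrow> K = K'"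
  using triangulation triangulation_interior_disjoint by (auto simp: conforming_triangulation_def)

text \<open>Being extreme in \<open>K\<close>, the end points of the edge are extreme in the common face and hence in
  \<open>K'\<close>, so a second triangle has the form \<open>a b c'\<close>. If \<open>c\<close> and \<open>c'\<close> are on the same side, the interiors
  meet near the midpoint of the edge. If they are on opposite sides, the two triangles cover a
  neighbourhood of the midpoint, which would then be interior to the closure of \<open>\<Omega>\<close>.\<close>

lemma unique_element_at_boundary_edge:
  assumes K: "convex hull {a, b, c} \<in> T" and o: "orient a b c \<noteq> 0"
    and e: "closed_segment a b \<subseteq> frontier \<Omega>"
    and K': "K' \<in> T" "closed_segment a b \<subseteq> K'"
  shows "K' = convex hull {a, b, c}"
proof (rule ccontr)
  let ?K = "convex hull {a, b, c}"
  assume neq: "K' \<noteq> ?K"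
  have face: "(?K \<inter> K') face_of ?K" "(?K \<inter> K') face_of K'"
    using triangulation K K'(1) unfolding conforming_triangulation_def triangulation_def
    by (metis, metis inf_commute)
  have vert: "v extreme_point_of K'" if "v = a \<or> v = b" for v
  proof -
    have "v extreme_point_of ?K"
      using vertices_triangle[OF o] that by (auto simp: vertices_def)
    moreover have "v \<in> ?K \<inter> K'" using that K'(2) by (auto simp: hull_inc)
    ultimately have "{v} face_of (?K \<inter> K')"
      using face(1) by (meson face_of_imp_subset face_of_singleton face_of_subset empty_subsetI insert_subset)
    then show ?thesis using face(2) face_of_trans face_of_singleton by blast
  qed
  obtain c' where c': "K' = convex hull {a, b, c'}" "orient a b c' \<noteq> 0"
    using two_simplex_triangle[OF two_simplex[OF K'(1)], of a b] vert triangle_distinct(1)[OF o] by blast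
  define m where "m = midpoint a b"
  have m_bary: "bary b z a m = 1/2" "bary z a b m = 1/2" "bary a b z m = 0" if "orient a b z \<noteq> 0" for z
  proof -
    have nz: "orient b z a \<noteq> 0" "orient z a b \<noteq> 0" using that orient_rotate by metis+
    have m': "m = (1/2) *\<^sub>R a + (1/2) *\<^sub>R b" by (simp add: m_def midpoint_def scaleR_right_distrib)
    show "bary a b z m = 0" by (rule bary_unique[OF that, of "1/2" "1/2"]) (simp_all add: m')
    show "bary b z a m = 1/2" by (rule bary_unique[OF nz(1), of "1/2" 0]) (simp_all add: m')
    show "bary z a b m = 1/2" by (rule bary_unique[OF nz(2), of 0 "1/2"]) (simp_all add: m')
  qed
  let ?U = "{x. 0 < bary b c a x \<and> 0 < bary c a b x \<and> 0 < bary b c' a x \<and> 0 < bary c' a b x}"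
  have U: "open ?U" by (intro open_Collect_conj open_Collect_less continuous_bary continuous_on_const)
  have mU: "m \<in> ?U" using m_bary[OF o] m_bary[OF c'(2)] by simp
  show False
  proof (cases "orient a b c * orient a b c' > 0")
    case True
    \<comment> \<open>moving from the midpoint towards c enters both interiors\<close>
    define \<gamma> where "\<gamma> t = m + t *\<^sub>R (c - m)" for t :: real
    have "isCont \<gamma> 0" unfolding \<gamma>_def by (intro continuous_intros)
    then have "\<forall>\<^sub>F t in at 0. \<gamma> t \<in> ?U"
      using topological_tendstoD[OF _ U, of \<gamma> m "at 0"] mU by (simp add: isCont_def \<gamma>_def)
    then have "\<forall>\<^sub>F t in at_right 0. \<gamma> t \<in> ?U" by (simp add: eventually_at_split)
    then have "\<forall>\<^sub>F t in at_right 0. 0 < t \<and> \<gamma> t \<in> ?U"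
      by (intro eventually_conj eventually_at_right_less)
    then obtain t where t: "t > 0" "\<gamma> t \<in> ?U"
      using eventually_happens'[OF trivial_limit_at_right_real] by blast
    have "orient a b m = 0" using m_bary(3)[OF o] o by (simp add: bary_def)
    then have "orient a b (\<gamma> t) = t * orient a b c"
      by (simp add: \<gamma>_def orient_def inner_add_right inner_diff_right algebra_simps)
    moreover have "orient a b c / orient a b c' > 0"
      using True by (auto simp: zero_less_divide_iff zero_less_mult_iff)
    ultimately have "bary a b c (\<gamma> t) > 0" "bary a b c' (\<gamma> t) > 0"
      using t(1) o mult_pos_pos[of t "orient a b c / orient a b c'"] by (simp_all add: bary_def)
    then have "\<gamma> t \<in> interior ?K" "\<gamma> t \<in> interior K'"
      using interior_triangle[OF o] interior_triangle[OF c'(2)] t(2) c'(1) by auto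
    then show False
      using elements_interior_disjoint[OF K K'(1)] interior_subset neq by blast
  next
    case False
    have "?U \<subseteq> ?K \<union> K'"
    proof
      fix x assume x: "x \<in> ?U"
      have "0 \<le> bary a b c x \<or> 0 \<le> bary a b c' x"
        using False o c'(2) by (auto simp: bary_def zero_le_divide_iff zero_less_mult_iff)
      then show "x \<in> ?K \<union> K'"
        using x triangle_eq[OF o] triangle_eq[OF c'(2)] c'(1) by auto
    qed
    also have "\<dots> \<subseteq> closure \<Omega>"
      using triangulation K K'(1) by (auto simp: conforming_triangulation_def)
    finally have "m \<in> interior (closure \<Omega>)" using U mU by (meson interiorI)
    moreover have "m \<in> frontier \<Omega>" using e by (auto simp: m_def)
    ultimately show False using lipschitz_domain_frontier[OF lipschitz] by blast
  qed
qed

text \<open>The vertex opposite to \<open>e\<close> in its adjacent triangle.\<close>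

definition apex :: "edge \<Rightarrow> real^2" where
  "apex e = (SOME c. convex hull {fst e, snd e, c} \<in> T \<and> orient (fst e) (snd e) c < 0)"

lemma
  assumes "e \<in> \<E>"
  shows adjacent_triangle_in: "convex hull {fst e, snd e, apex e} \<in> T"
    and orient_apex: "orient (fst e) (snd e) (apex e) < 0"
proof -
  have "\<exists>c. convex hull {fst e, snd e, c} \<in> T \<and> orient (fst e) (snd e) c < 0"
    using assms by (auto simp: boundary_edges_def orient_def)
  then show "convex hull {fst e, snd e, apex e} \<in> T" "orient (fst e) (snd e) (apex e) < 0"
    using someI_ex[of "\<lambda>c. convex hull {fst e, snd e, c} \<in> T \<and> orient (fst e) (snd e) c < 0"]
    by (auto simp: apex_def)
qed

lemma edge_frontier: "e \<in> \<E> \<Longrightarrow> closed_segment (fst e) (snd e) \<subseteq> frontier \<Omega>"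
  by (auto simp: boundary_edges_def)

lemma adj_elem_eq:
  assumes "e \<in> \<E>" shows "adj_elem T e = convex hull {fst e, snd e, apex e}"
  unfolding adj_elem_def edge_set_def
proof (rule the_equality)
  show "convex hull {fst e, snd e, apex e} \<in> T \<and> closed_segment (fst e) (snd e) \<subseteq> convex hull {fst e, snd e, apex e}"
    using adjacent_triangle_in[OF assms] by (simp add: segment_convex_hull hull_mono)
  show "K = convex hull {fst e, snd e, apex e}" if "K \<in> T \<and> closed_segment (fst e) (snd e) \<subseteq> K" for K
    using that adjacent_triangle_in[OF assms] orient_apex[OF assms] edge_frontier[OF assms]
    by (intro unique_element_at_boundary_edge) auto
qed

lemma adj_elem_in: "e \<in> \<E> \<Longrightarrow> adj_elem T e \<in> T"
  by (simp add: adj_elem_eq adjacent_triangle_in)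

lemma vertices_adj_elem: "e \<in> \<E> \<Longrightarrow> vertices (adj_elem T e) = {fst e, snd e, apex e}"
  by (metis adj_elem_eq orient_apex vertices_triangle less_irrefl)

text \<open>Edges are ordered pairs of vertices, of which there are nine; the crude count is enough for the
  stability estimate.\<close>

lemma finite_edges_of_element:
  assumes "K \<in> T"
  shows "finite {e\<in>\<E>. adj_elem T e = K}" "card {e\<in>\<E>. adj_elem T e = K} \<le> 9"
proof -
  let ?S = "{e\<in>\<E>. adj_elem T e = K}"
  have sub: "?S \<subseteq> vertices K \<times> vertices K"
  proof
    fix e assume "e \<in> ?S"
    then have "vertices K = {fst e, snd e, apex e}" using vertices_adj_elem by blast
    then show "e \<in> vertices K \<times> vertices K" by (simp add: mem_Times_iff)
  qed
  have "finite (vertices K) \<and> card (vertices K) = 3"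
  proof -
    obtain C where C: "finite C" "\<not> affine_dependent C" "int (card C) = 2 + 1" "K = convex hull C"
      using two_simplex[OF assms] by (auto simp: simplex)
    then have "vertices K = C"
      by (auto simp: vertices_def extreme_point_of_convex_hull_affine_independent)
    then show ?thesis using C by simp
  qed
  then have *: "finite (vertices K \<times> vertices K)" "card (vertices K \<times> vertices K) = 9"
    by (auto simp: card_cartesian_product)
  show "finite ?S" using sub *(1) by (rule finite_subset)
  show "card ?S \<le> 9" using card_mono[OF *(1) sub] *(2) by simp
qed

lemma finite_edges: "finite \<E>"
proof -
  have "\<E> = (\<Union>K\<in>T. {e\<in>\<E>. adj_elem T e = K})" using adj_elem_in by auto
  moreover have "finite T" using triangulation by (auto simp: conforming_triangulation_def triangulation_def)
  ultimately show ?thesis using finite_edges_of_element by (metis (no_types, lifting) finite_UN)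
qed

text \<open>The two vertex triples are permutations of each other with the same orientation, hence cyclic
  rotations.\<close>

lemma edges_of_same_element:
  assumes "e \<in> \<E>" "e' \<in> \<E>" "adj_elem T e' = adj_elem T e"
  shows "(fst e', snd e', apex e') \<in>
    {(fst e, snd e, apex e), (snd e, apex e, fst e), (apex e, fst e, snd e)}"
proof -
  have V: "{fst e', snd e', apex e'} = {fst e, snd e, apex e}"
    using vertices_adj_elem assms by metis
  have o: "orient (fst e) (snd e) (apex e) < 0" "orient (fst e') (snd e') (apex e') < 0"
    using assms orient_apex by auto
  have rev: "orient b a c = - orient a b c" "orient a c b = - orient a b c" "orient c b a = - orient a b c" for a b c
    by (simp_all add: orient_coords algebra_simps)
  have "fst e' \<noteq> snd e'" "snd e' \<noteq> apex e'" "fst e' \<noteq> apex e'" using o(2) by auto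
  with V have "(fst e', snd e', apex e') \<in>
    {(fst e, snd e, apex e), (snd e, apex e, fst e), (apex e, fst e, snd e),
     (snd e, fst e, apex e), (fst e, apex e, snd e), (apex e, snd e, fst e)}"
  proof -
    have "fst e' \<in> {fst e, snd e, apex e}" "snd e' \<in> {fst e, snd e, apex e}"
      "apex e' \<in> {fst e, snd e, apex e}"
      using V by blast+
    then show ?thesis using \<open>fst e' \<noteq> snd e'\<close> \<open>snd e' \<noteq> apex e'\<close> \<open>fst e' \<noteq> apex e'\<close>
      unfolding insert_iff empty_iff prod.inject by argo
  qed
  then show ?thesis using o rev[of "fst e" "snd e" "apex e"] by auto
qed

section \<open>Edge bubbles\<close>

text \<open>The barycentric coordinates of the two end points of \<open>e\<close> in its adjacent triangle, extended to the
  plane, and their gradients.\<close>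

definition "coord_init e = bary (snd e) (apex e) (fst e)"
definition "coord_final e = bary (apex e) (fst e) (snd e)"
definition "grad_init e = bary_grad (snd e) (apex e) (fst e)"
definition "grad_final e = bary_grad (apex e) (fst e) (snd e)"

definition "bubble_poly e x = coord_init e x * coord_final e x"
definition "bubble_grad e x = coord_init e x *\<^sub>R grad_final e + coord_final e x *\<^sub>R grad_init e"
text \<open>A bound of \<open>bubble_grad e\<close> on the adjacent triangle, where both coordinates are at most one.\<close>

definition "grad_bound e = norm (grad_init e) + norm (grad_final e)"

lemma domain_facts: "open \<Omega>" "\<Omega> \<in> lmeasurable" "\<Omega> \<in> sets lebesgue"
  using lipschitz by (auto simp: lipschitz_domain_def lmeasurable_open)

lemma compact_adj_elem: "e \<in> \<E> \<Longrightarrow> compact (adj_elem T e)"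
  by (simp add: adj_elem_eq compact_convex_hull)

lemma edge_bubble_eq:
  assumes "e \<in> \<E>"
  shows "edge_bubble T e x = indicat_real (adj_elem T e) x * bubble_poly e x"
proof -
  have o: "orient (snd e) (apex e) (fst e) \<noteq> 0" "orient (apex e) (fst e) (snd e) \<noteq> 0"
    using orient_apex[OF assms] orient_rotate by (metis less_irrefl)+
  have "barycentric (vertices (adj_elem T e)) x (fst e) = coord_init e x"
    "barycentric (vertices (adj_elem T e)) x (snd e) = coord_final e x"
    using barycentric_triangle[OF o(1), of x] barycentric_triangle[OF o(2), of x]
    by (simp_all add: vertices_adj_elem[OF assms] coord_init_def coord_final_def insert_commute)
  then show ?thesis by (simp add: edge_bubble_def bubble_poly_def indicator_def Let_def)
qed

lemma coord_bounds:
  assumes "e \<in> \<E>" "x \<in> adj_elem T e"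
  shows "0 \<le> coord_init e x" "coord_init e x \<le> 1" "0 \<le> coord_final e x" "coord_final e x \<le> 1"
proof -
  have o: "orient (fst e) (snd e) (apex e) \<noteq> 0" using orient_apex[OF assms(1)] by simp
  show "0 \<le> coord_init e x" "coord_init e x \<le> 1" "0 \<le> coord_final e x" "coord_final e x \<le> 1"
    using assms(2) bary_sum[OF o, of x] unfolding adj_elem_eq[OF assms(1)] triangle_eq[OF o]
    by (auto simp: coord_init_def coord_final_def)
qed

lemma has_derivative_coord:
  "(coord_init e has_derivative (\<lambda>v. grad_init e \<bullet> v)) (at x)"
  "(coord_final e has_derivative (\<lambda>v. grad_final e \<bullet> v)) (at x)"
  by (simp_all add: coord_init_def coord_final_def grad_init_def grad_final_def has_derivative_bary)

lemma continuous_coord: "continuous_on S (coord_init e)" "continuous_on S (coord_final e)"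
  by (simp_all add: coord_init_def coord_final_def continuous_bary)

lemma continuous_bubble: "continuous_on S (bubble_poly e)" "continuous_on S (bubble_grad e)"
  unfolding bubble_poly_def bubble_grad_def by (intro continuous_intros continuous_coord)+

lemma has_derivative_bubble_poly: "(bubble_poly e has_derivative (\<lambda>v. bubble_grad e x \<bullet> v)) (at x)"
  unfolding bubble_poly_def
  by (rule has_derivative_eq_rhs[OF has_derivative_mult[OF has_derivative_coord]])
     (auto simp: bubble_grad_def inner_add_left)

lemma has_derivative_edge_bubble:
  assumes e: "e \<in> \<E>" and x: "x \<notin> frontier (adj_elem T e)"
  shows "(edge_bubble T e has_derivative (\<lambda>v. indicator (adj_elem T e) x * (bubble_grad e x \<bullet> v))) (at x)"
proof (cases "x \<in> adj_elem T e")
  case True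
  then have "x \<in> interior (adj_elem T e)" using x closure_subset by (auto simp: frontier_def)
  with has_derivative_bubble_poly[of e x] have "(edge_bubble T e has_derivative (\<lambda>v. bubble_grad e x \<bullet> v)) (at x)"
    by (rule has_derivative_transform_within_open[OF _ open_interior])
       (use interior_subset[of "adj_elem T e"] in \<open>auto simp: edge_bubble_eq[OF e] indicator_def\<close>)
  with True show ?thesis by simp
next
  case False
  have "((\<lambda>_. 0) has_derivative (\<lambda>_. 0)) (at x)" by simp
  then have "(edge_bubble T e has_derivative (\<lambda>_. 0)) (at x)"
    by (rule has_derivative_transform_within_open[of _ _ _ _ "- adj_elem T e"])
       (use False compact_adj_elem[OF e] in \<open>auto simp: edge_bubble_eq[OF e] compact_imp_closed\<close>)
  with False show ?thesis by simp
qed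

lemma norm_bubble_grad_le:
  assumes "e \<in> \<E>" "x \<in> adj_elem T e" shows "norm (bubble_grad e x) \<le> grad_bound e"
proof -
  note c = coord_bounds[OF assms]
  have "norm (bubble_grad e x) \<le> coord_init e x * norm (grad_final e) + coord_final e x * norm (grad_init e)"
    unfolding bubble_grad_def using c(1,3) norm_triangle_ineq
    by (metis (no_types) abs_of_nonneg norm_scaleR)
  also have "\<dots> \<le> 1 * norm (grad_final e) + 1 * norm (grad_init e)"
    using c by (intro add_mono mult_right_mono) auto
  finally show ?thesis by (simp add: grad_bound_def)
qed

lemma AE_off_frontier: "e \<in> \<E> \<Longrightarrow> AE x in lebesgue. x \<notin> frontier (adj_elem T e)"
  using negligible_convex_frontier[of "adj_elem T e"]
  by (simp add: adj_elem_eq convex_convex_hull negligible_iff_null_sets AE_not_in)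

text \<open>The bubble alone is discontinuous across \<open>e\<close>, where it jumps to zero. The test function
  vanishes there, since \<open>e\<close> lies in the frontier of the domain, and repairs this.\<close>

lemma bubble_times_test_function_lipschitz:
  assumes e: "e \<in> \<E>" and \<phi>: "\<phi> \<in> test_functions \<Omega>"
  obtains L where "L-lipschitz_on UNIV (\<lambda>x. edge_bubble T e x * \<phi> x)"
proof -
  let ?K = "adj_elem T e"
  obtain B where B: "B \<ge> 0" "\<And>x. \<bar>\<phi> x\<bar> \<le> B" using test_function_bounded[OF \<phi>] by blast
  obtain L\<phi> where L\<phi>: "L\<phi>-lipschitz_on UNIV \<phi>" using test_function_lipschitz[OF \<phi>] by blast
  have K: "closed ?K" using compact_adj_elem[OF e] by (rule compact_imp_closed)
  have cvx: "convex ?K" by (simp add: adj_elem_eq[OF e])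
  have q_lip: "\<bar>bubble_poly e x - bubble_poly e y\<bar> \<le> grad_bound e * norm (x - y)"
    if "x \<in> ?K" "y \<in> ?K" for x y
  proof -
    have "norm (bubble_poly e x - bubble_poly e y) \<le> grad_bound e * norm (x - y)"
    proof (rule differentiable_bound[OF cvx _ _ that])
      show "(bubble_poly e has_derivative (\<lambda>v. bubble_grad e z \<bullet> v)) (at z within ?K)" for z
        using has_derivative_bubble_poly by (rule has_derivative_at_withinI)
      show "onorm (\<lambda>v. bubble_grad e z \<bullet> v) \<le> grad_bound e" if "z \<in> ?K" for z
        using norm_bubble_grad_le[OF e that]
        by (intro onorm_le) (metis Cauchy_Schwarz_ineq2 mult_right_mono norm_ge_zero order_trans real_norm_def)
    qed
    then show ?thesis by simp
  qed
  have "(grad_bound e * B + L\<phi>)-lipschitz_on ?K (\<lambda>x. edge_bubble T e x * \<phi> x)"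
  proof (rule lipschitz_onI)
    show "0 \<le> grad_bound e * B + L\<phi>"
      using B(1) lipschitz_on_nonneg[OF L\<phi>] by (simp add: grad_bound_def)
    fix x y assume xy: "x \<in> ?K" "y \<in> ?K"
    let ?q = "bubble_poly e"
    have "\<bar>?q y\<bar> \<le> 1" using coord_bounds[OF e xy(2)] by (simp add: bubble_poly_def abs_mult mult_le_one)
    moreover have "\<bar>\<phi> x - \<phi> y\<bar> \<le> L\<phi> * norm (x - y)"
      using lipschitz_onD[OF L\<phi>, of x y] by (simp add: dist_norm)
    ultimately have "\<bar>?q y\<bar> * \<bar>\<phi> x - \<phi> y\<bar> \<le> 1 * (L\<phi> * norm (x - y))"
      by (intro mult_mono) auto
    moreover have "\<bar>?q x - ?q y\<bar> * \<bar>\<phi> x\<bar> \<le> (grad_bound e * norm (x - y)) * B"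
      using q_lip[OF xy] B by (intro mult_mono) (auto simp: grad_bound_def)
    moreover have "?q x * \<phi> x - ?q y * \<phi> y = (?q x - ?q y) * \<phi> x + ?q y * (\<phi> x - \<phi> y)"
      by (simp add: algebra_simps)
    then have "\<bar>?q x * \<phi> x - ?q y * \<phi> y\<bar> \<le> \<bar>?q x - ?q y\<bar> * \<bar>\<phi> x\<bar> + \<bar>?q y\<bar> * \<bar>\<phi> x - \<phi> y\<bar>"
      by (metis abs_mult abs_triangle_ineq)
    ultimately show "dist (edge_bubble T e x * \<phi> x) (edge_bubble T e y * \<phi> y)
        \<le> (grad_bound e * B + L\<phi>) * dist x y"
      using xy by (simp add: edge_bubble_eq[OF e] dist_norm algebra_simps)
  qed
  then have "(grad_bound e * B + L\<phi>)-lipschitz_on UNIV (\<lambda>x. edge_bubble T e x * \<phi> x)"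
  proof (rule lipschitz_on_extend_by_0[OF K])
    fix x assume x: "x \<in> frontier ?K"
    then have xK: "x \<in> ?K" using K by (simp add: frontier_def)
    have o: "orient (fst e) (snd e) (apex e) \<noteq> 0" using orient_apex[OF e] by simp
    have "coord_init e x = 0 \<or> coord_final e x = 0 \<or> bary (fst e) (snd e) (apex e) x = 0"
      using frontier_triangle_bary[OF o] x unfolding adj_elem_eq[OF e]
      by (simp add: coord_init_def coord_final_def)
    moreover have "\<phi> x = 0" if "bary (fst e) (snd e) (apex e) x = 0"
    proof -
      have "x \<in> closed_segment (fst e) (snd e)"
        using opposite_edge[OF o _ that] xK unfolding adj_elem_eq[OF e] by simp
      then have "x \<in> frontier \<Omega>" using edge_frontier[OF e] by blast
      then have "x \<notin> \<Omega>" using domain_facts(1) by (simp add: frontier_def interior_open)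
      then show ?thesis using test_function_outside[OF \<phi>] by blast
    qed
    ultimately show "edge_bubble T e x * \<phi> x = 0"
      by (auto simp: edge_bubble_eq[OF e] bubble_poly_def)
  qed (simp add: edge_bubble_eq[OF e])
  then show ?thesis by (rule that)
qed

lemma
  assumes e: "e \<in> \<E>" and \<phi>: "\<phi> \<in> test_functions \<Omega>"
  shows integrable_bubble_test: "integrable lebesgue (\<lambda>x. edge_bubble T e x * \<phi> x)"
    and integrable_bubble_grad_test:
      "integrable lebesgue (\<lambda>x. indicat_real (adj_elem T e) x * (bubble_grad e x $ j) * \<phi> x)"
proof -
  have c: "continuous_on (adj_elem T e) \<phi>"
    using test_function_continuous[OF \<phi>] by (rule continuous_on_subset) simp
  have "integrable lebesgue (\<lambda>x. indicator (adj_elem T e) x * (bubble_poly e x * \<phi> x))"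
    by (intro integrable_indicator_mult_compact compact_adj_elem e continuous_intros continuous_bubble c)
  then show "integrable lebesgue (\<lambda>x. edge_bubble T e x * \<phi> x)"
    by (simp add: edge_bubble_eq[OF e] mult.assoc)
  have "integrable lebesgue (\<lambda>x. indicator (adj_elem T e) x * (bubble_grad e x $ j * \<phi> x))"
    by (intro integrable_indicator_mult_compact compact_adj_elem e continuous_intros continuous_bubble c)
  then show "integrable lebesgue (\<lambda>x. indicat_real (adj_elem T e) x * (bubble_grad e x $ j) * \<phi> x)"
    by (simp add: mult.assoc)
qed

text \<open>The extension by zero of the bubble times a test function is Lipschitz with compact support; its
  directional derivative, given by the product rule off the frontier of the triangle, has integral
  zero.\<close>

lemma bubble_weak_partial:
  assumes e: "e \<in> \<E>" and \<phi>: "\<phi> \<in> test_functions \<Omega>"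
  shows "(LINT x|lebesgue. edge_bubble T e x * partial j \<phi> x)
     = - (LINT x|lebesgue. indicat_real (adj_elem T e) x * (bubble_grad e x $ j) * \<phi> x)"
proof -
  let ?K = "adj_elem T e"
  let ?F = "\<lambda>x. edge_bubble T e x * \<phi> x"
  let ?G = "\<lambda>x. edge_bubble T e x * partial j \<phi> x + indicat_real ?K x * (bubble_grad e x $ j) * \<phi> x"
  obtain L where L: "L-lipschitz_on UNIV ?F"
    using bubble_times_test_function_lipschitz[OF e \<phi>] by blast
  obtain R where R: "\<And>x. x \<in> ?K \<Longrightarrow> norm x \<le> R"
    using compact_imp_bounded[OF compact_adj_elem[OF e]] bounded_iff by metis
  have int: "integrable lebesgue (\<lambda>x. edge_bubble T e x * partial j \<phi> x)"
    "integrable lebesgue (\<lambda>x. indicat_real ?K x * (bubble_grad e x $ j) * \<phi> x)"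
    by (rule integrable_bubble_test[OF e test_function_partial[OF \<phi>]],
        rule integrable_bubble_grad_test[OF e \<phi>])
  have "integral\<^sup>L lebesgue ?G = 0"
  proof (rule integral_directional_derivative_eq_0[OF L])
    show "norm x \<le> R" if "?F x \<noteq> 0" for x
      using that R[of x] by (auto simp: edge_bubble_eq[OF e] indicator_def split: if_splits)
    show "?G \<in> borel_measurable lebesgue" using int by (intro borel_measurable_add) auto
    show "AE x in lebesgue. ((\<lambda>s. ?F (x + s *\<^sub>R axis j 1)) has_real_derivative ?G x) (at 0)"
      using AE_off_frontier[OF e]
    proof eventually_elim
      case (elim x)
      obtain \<phi>' where \<phi>': "(\<phi> has_derivative \<phi>') (at x)"
        using \<phi> smooth_differentiable[of \<phi> x] by (auto simp: test_functions_def differentiable_def)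
      have "partial j \<phi> x = \<phi>' (axis j 1)"
        unfolding partial_def by (rule dir_deriv_eq(1)[OF \<phi>'])
      moreover note dir_deriv_eq(2)[OF has_derivative_mult[OF has_derivative_edge_bubble[OF e elim] \<phi>'],
          of "axis j 1"]
      ultimately show ?case by (simp add: inner_axis)
    qed
  qed
  then show ?thesis using int by simp
qed

text \<open>A null set off which all bubbles are differentiable.\<close>

definition "skeleton = (\<Union>e\<in>\<E>. frontier (adj_elem T e))"

lemma AE_off_skeleton: "AE x in lebesgue. x \<notin> skeleton"
proof -
  have "AE x in lebesgue. \<forall>e\<in>\<E>. x \<notin> frontier (adj_elem T e)"
    using finite_edges AE_off_frontier by (simp add: AE_finite_all)
  then show ?thesis by (simp add: skeleton_def)
qed

lemma interior_adj_elem: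
  assumes e: "e \<in> \<E>" shows "interior (adj_elem T e) \<noteq> {}"
proof -
  let ?x = "(1/3) *\<^sub>R fst e + (1/3) *\<^sub>R snd e + (1/3) *\<^sub>R apex e"
  have o: "orient (fst e) (snd e) (apex e) \<noteq> 0" "orient (snd e) (apex e) (fst e) \<noteq> 0"
    "orient (apex e) (fst e) (snd e) \<noteq> 0"
    using orient_apex[OF e] orient_rotate by (metis less_irrefl)+
  have "bary (fst e) (snd e) (apex e) ?x = 1/3" "bary (snd e) (apex e) (fst e) ?x = 1/3"
    "bary (apex e) (fst e) (snd e) ?x = 1/3"
    by (rule bary_unique[OF o(1), of "1/3" "1/3"] bary_unique[OF o(2), of "1/3" "1/3"]
        bary_unique[OF o(3), of "1/3" "1/3"]; simp add: add_ac)+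
  then have "?x \<in> interior (adj_elem T e)"
    unfolding adj_elem_eq[OF e] by (intro interior_triangle[OF o(1)]) auto
  then show ?thesis by blast
qed

text \<open>Off the skeleton a point of an adjacent triangle is interior to it and so belongs to no other
  element.\<close>

lemma indicator_adj_elem:
  assumes "e \<in> \<E>" "K \<in> T" "x \<in> K" "x \<notin> skeleton"
  shows "indicat_real (adj_elem T e) x = (if adj_elem T e = K then 1 else 0)"
proof (cases "x \<in> adj_elem T e")
  case True
  have "x \<notin> frontier (adj_elem T e)" using assms by (auto simp: skeleton_def)
  then have "x \<in> interior (adj_elem T e)"
    using True closure_subset[of "adj_elem T e"] by (auto simp: frontier_def)
  then have "adj_elem T e = K"
    using elements_interior_disjoint[OF adj_elem_in[OF assms(1)] assms(2)] assms(3) by blast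
  with True show ?thesis by simp
next
  case False
  with assms(3) have "adj_elem T e \<noteq> K" by metis
  with False show ?thesis by simp
qed

lemma element_lebesgue:
  assumes "K \<in> T" shows "K \<in> sets lebesgue"
proof -
  obtain C where "finite C" "K = convex hull C" using two_simplex[OF assms] unfolding simplex by blast
  then have "K \<in> lmeasurable"
    by (intro lmeasurable_compact) (simp only: finite_imp_compact_convex_hull)
  then show ?thesis by (rule fmeasurableD)
qed

section \<open>Bubble gradients and tensors along the edges\<close>

lemma edge_length_pos: "e \<in> \<E> \<Longrightarrow> edge_length e > 0"
  using orient_apex[of e] by (auto simp: edge_length_def)

lemma norm_edge_tangent: "e \<in> \<E> \<Longrightarrow> norm (edge_tangent e) = 1"
  using edge_length_pos[of e] by (simp add: edge_tangent_def edge_length_def dist_norm norm_minus_commute)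

lemma coords_on_edge:
  assumes e: "e \<in> \<E>" and x: "x = fst e + \<tau> *\<^sub>R (snd e - fst e)"
  shows "coord_init e x = 1 - \<tau>" "coord_final e x = \<tau>" "bary (fst e) (snd e) (apex e) x = 0"
proof -
  have o: "orient (fst e) (snd e) (apex e) \<noteq> 0" "orient (snd e) (apex e) (fst e) \<noteq> 0"
    "orient (apex e) (fst e) (snd e) \<noteq> 0"
    using orient_apex[OF e] orient_rotate by (metis less_irrefl)+
  have x': "x = (1 - \<tau>) *\<^sub>R fst e + \<tau> *\<^sub>R snd e" by (simp add: x algebra_simps)
  show "bary (fst e) (snd e) (apex e) x = 0"
    by (rule bary_unique[OF o(1), of "1 - \<tau>" \<tau>]) (simp_all add: x')
  show "coord_init e x = 1 - \<tau>" unfolding coord_init_def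
    by (rule bary_unique[OF o(2), of \<tau> 0]) (simp_all add: x' add.commute)
  show "coord_final e x = \<tau>" unfolding coord_final_def
    by (rule bary_unique[OF o(3), of 0 "1 - \<tau>"]) (simp_all add: x')
qed

text \<open>From the initial to the final end point the three coordinates change by \<open>-1\<close>, \<open>1\<close> and \<open>0\<close>.\<close>

lemma grads_along_edge:
  assumes e: "e \<in> \<E>"
  shows "grad_init e \<bullet> edge_tangent e = - 1 / edge_length e"
    "grad_final e \<bullet> edge_tangent e = 1 / edge_length e"
    "bary_grad (fst e) (snd e) (apex e) \<bullet> edge_tangent e = 0"
proof -
  note c0 = coords_on_edge[OF e, of "fst e" 0, simplified] and c1 = coords_on_edge[OF e, of "snd e" 1, simplified]
  have "grad_init e \<bullet> (snd e - fst e) = - 1" "grad_final e \<bullet> (snd e - fst e) = 1"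
    "bary_grad (fst e) (snd e) (apex e) \<bullet> (snd e - fst e) = 0"
    using c0 c1 bary_affine[of "snd e" "apex e" "fst e" "snd e" "fst e"]
      bary_affine[of "apex e" "fst e" "snd e" "snd e" "fst e"]
      bary_affine[of "fst e" "snd e" "apex e" "snd e" "fst e"]
    unfolding coord_init_def coord_final_def grad_init_def grad_final_def by simp_all
  then show "grad_init e \<bullet> edge_tangent e = - 1 / edge_length e"
    "grad_final e \<bullet> edge_tangent e = 1 / edge_length e"
    "bary_grad (fst e) (snd e) (apex e) \<bullet> edge_tangent e = 0"
    by (simp_all add: edge_tangent_def divide_inverse_commute)
qed

text \<open>Another boundary edge of the same triangle contains the apex of \<open>e\<close>, so one factor of its bubble is
  the coordinate of that apex, which is zero along \<open>e\<close>.\<close>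

lemma other_bubble_on_edge:
  assumes e: "e \<in> \<E>" "e' \<in> \<E>" "adj_elem T e' = adj_elem T e" "e' \<noteq> e" and x: "x \<in> edge_set e"
  shows "bubble_grad e' x \<bullet> edge_tangent e = 0"
    and "(grad_init e' \<bullet> edge_tangent e) * (grad_final e' \<bullet> edge_tangent e) = 0"
proof -
  obtain \<tau> where "x = (1 - \<tau>) *\<^sub>R fst e + \<tau> *\<^sub>R snd e"
    using x by (auto simp: edge_set_def closed_segment_def)
  then have x': "x = fst e + \<tau> *\<^sub>R (snd e - fst e)" by (simp add: algebra_simps)
  note z = coords_on_edge(3)[OF e(1) x'] grads_along_edge(3)[OF e(1)]
  have "(fst e', snd e', apex e') \<in> {(snd e, apex e, fst e), (apex e, fst e, snd e)}"
    using edges_of_same_element[OF e(1,2,3)] e(4) by (auto simp: prod_eq_iff)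
  then have "coord_final e' x = 0 \<and> grad_final e' \<bullet> edge_tangent e = 0 \<or>
      coord_init e' x = 0 \<and> grad_init e' \<bullet> edge_tangent e = 0"
    using z by (auto simp: coord_init_def coord_final_def grad_init_def grad_final_def)
  then show "bubble_grad e' x \<bullet> edge_tangent e = 0"
    "(grad_init e' \<bullet> edge_tangent e) * (grad_final e' \<bullet> edge_tangent e) = 0"
    by (auto simp: bubble_grad_def inner_add_left)
qed

text \<open>At the fraction \<open>\<tau>\<close> of the edge the bubble is \<open>\<tau> (1 - \<tau>)\<close>, with derivative
  \<open>(1 - 2 \<tau>) / |e|\<close> by arclength.\<close>

lemma bubble_on_own_edge:
  assumes e: "e \<in> \<E>" and x: "x \<in> edge_set e"
  shows "bubble_grad e x \<bullet> edge_tangent e = - edge_ell e x / edge_length e"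
proof -
  obtain \<tau> where \<tau>: "0 \<le> \<tau>" "x = (1 - \<tau>) *\<^sub>R fst e + \<tau> *\<^sub>R snd e"
    using x by (auto simp: edge_set_def closed_segment_def)
  then have x': "x = fst e + \<tau> *\<^sub>R (snd e - fst e)" by (simp add: algebra_simps)
  have "dist (fst e) x = \<tau> * edge_length e"
    using \<tau>(1) by (simp add: x' dist_norm edge_length_def norm_minus_commute)
  then have "edge_ell e x = 2 * \<tau> - 1"
    using edge_length_pos[OF e] by (simp add: edge_ell_def)
  moreover have "bubble_grad e x \<bullet> edge_tangent e = (1 - \<tau>) * (1 / edge_length e) + \<tau> * (- 1 / edge_length e)"
    by (simp add: bubble_grad_def inner_add_left grads_along_edge[OF e] coords_on_edge[OF e x'])
  ultimately show ?thesis by (simp add: diff_divide_distrib)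
qed

text \<open>The symmetric curl of \<open>bubble_poly e\<close> times the normal of \<open>e\<close>, since
  \<open>Curl (b n) = n (- rot (\<nabla>b))\<^sup>T\<close>.\<close>

definition "bubble_tensor e x = sym_part (outer (edge_normal e) (- rot (bubble_grad e x)))"

lemma coord_affine:
  "coord_init e x = bary (snd e) (apex e) (fst e) 0 + grad_init e \<bullet> x"
  "coord_final e x = bary (apex e) (fst e) (snd e) 0 + grad_final e \<bullet> x"
  unfolding coord_init_def coord_final_def grad_init_def grad_final_def
  using bary_affine[of _ _ _ x 0] by simp_all

lemma rotated_bubble_grad_in_RT1: "(\<lambda>x. - rot (bubble_grad e x)) \<in> RT 1"
proof (rule affine_in_RT1)
  fix i :: 2
  obtain c1 c2 where c: "\<And>x. coord_init e x = c1 + grad_init e \<bullet> x" "\<And>x. coord_final e x = c2 + grad_final e \<bullet> x"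
    using coord_affine by blast
  let ?r = "\<lambda>v. - rot v $ i"
  have "(- rot (bubble_grad e x)) $ i =
      (c1 * ?r (grad_final e) + c2 * ?r (grad_init e))
      + (?r (grad_final e) *\<^sub>R grad_init e + ?r (grad_init e) *\<^sub>R grad_final e) \<bullet> x" for x
    using exhaust_2[of i] by (auto simp: bubble_grad_def c inner_add_left algebra_simps)
  then show "\<exists>c g. \<forall>x. (- rot (bubble_grad e x)) $ i = c + g \<bullet> x" by blast
qed

lemma has_derivative_bubble_tensor:
  "(bubble_tensor e has_derivative (\<lambda>v. sym_part (outer (edge_normal e)
     (- rot ((grad_init e \<bullet> v) *\<^sub>R grad_final e + (grad_final e \<bullet> v) *\<^sub>R grad_init e))))) (at x)"
proof -
  let ?L = "\<lambda>w. sym_part (outer (edge_normal e) (- rot w))"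
  have "linear ?L"
    by (rule linearI)
       (simp_all add: sym_part_def outer_def transpose_def vec_eq_iff forall_2 field_simps)
  then have "bounded_linear ?L" by (simp add: linear_conv_bounded_linear)
  moreover have "(bubble_grad e has_derivative
      (\<lambda>v. (grad_init e \<bullet> v) *\<^sub>R grad_final e + (grad_final e \<bullet> v) *\<^sub>R grad_init e)) (at x)"
    unfolding bubble_grad_def
    by (intro has_derivative_add has_derivative_scaleR_left has_derivative_coord)
  ultimately show ?thesis
    unfolding bubble_tensor_def by (rule bounded_linear.has_derivative)
qed

lemma continuous_bubble_tensor: "continuous_on S (bubble_tensor e)"
  unfolding continuous_on_eq_continuous_within
  by (intro ballI has_derivative_continuous[OF has_derivative_at_withinI[OF has_derivative_bubble_tensor]])

lemma norm_bubble_tensor_le: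
  assumes "e \<in> \<E>" "x \<in> adj_elem T e" shows "norm (bubble_tensor e x) \<le> grad_bound e"
proof -
  have "norm (bubble_tensor e x) \<le> norm (edge_normal e) * norm (- rot (bubble_grad e x))"
    unfolding bubble_tensor_def by (rule norm_sym_outer_le)
  also have "\<dots> = norm (bubble_grad e x)"
    using norm_edge_tangent[OF assms(1)] by (simp add: edge_normal_def)
  finally show ?thesis using norm_bubble_grad_le[OF assms] by simp
qed

section \<open>The bubble field of given edge weights\<close>

context
  fixes \<mu> :: "edge \<Rightarrow> real"
begin

abbreviation "field \<equiv> bubble_field \<Omega> T \<mu>"
abbreviation "weight e \<equiv> edge_length e * \<mu> e"

lemma partial_bubble_field:
  assumes "x \<notin> skeleton"
  shows "partial j (\<lambda>y. field y $ i) x =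
    (\<Sum>e\<in>\<E>. weight e * edge_normal e $ i * (indicat_real (adj_elem T e) x * bubble_grad e x $ j))"
proof -
  have "((\<lambda>y. \<Sum>e\<in>\<E>. weight e * edge_normal e $ i * edge_bubble T e y) has_derivative
     (\<lambda>v. \<Sum>e\<in>\<E>. weight e * edge_normal e $ i * (indicat_real (adj_elem T e) x * (bubble_grad e x \<bullet> v)))) (at x)"
    using assms by (intro has_derivative_sum has_derivative_mult_right has_derivative_edge_bubble)
      (auto simp: skeleton_def)
  moreover have "(\<lambda>y. field y $ i) = (\<lambda>y. \<Sum>e\<in>\<E>. weight e * edge_normal e $ i * edge_bubble T e y)"
    by (simp add: bubble_field_def sum_component mult_ac)
  ultimately show ?thesis
    unfolding partial_def by (simp add: dir_deriv_eq(1) inner_axis)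
qed

lemma sCurl_bubble_field:
  assumes "x \<notin> skeleton"
  shows "sCurl field x = (\<Sum>e\<in>\<E>. (weight e * indicat_real (adj_elem T e) x) *\<^sub>R bubble_tensor e x)"
proof -
  have "sCurl field x $ i $ j =
      (\<Sum>e\<in>\<E>. (weight e * indicat_real (adj_elem T e) x) *\<^sub>R bubble_tensor e x) $ i $ j" for i j
    using exhaust_2[of i] exhaust_2[of j]
    by (auto simp: sCurl_entries partial_bubble_field[OF assms] sum_component bubble_tensor_def
        sym_part_def outer_def transpose_def sum_negf[symmetric] sum_subtractf[symmetric]
        sum_divide_distrib field_simps intro!: sum.cong)
  then show ?thesis by (simp add: vec_eq_iff)
qed

lemma measurable_cutoff:
  fixes f :: "real^2 \<Rightarrow> 'a::euclidean_space"
  assumes "e \<in> \<E>" "continuous_on UNIV f"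
  shows "(\<lambda>x. indicat_real (adj_elem T e) x *\<^sub>R f x) \<in> borel_measurable lebesgue"
proof -
  have "f \<in> borel_measurable borel" using assms(2) by (rule borel_measurable_continuous_onI)
  moreover have "adj_elem T e \<in> sets borel"
    using compact_adj_elem[OF assms(1)] by (simp add: borel_compact)
  ultimately have "(\<lambda>x. indicat_real (adj_elem T e) x *\<^sub>R f x) \<in> borel_measurable lborel" by simp
  then show ?thesis by (rule measurable_completion)
qed

lemma partial_bubble_field_in_L2:
  "partial j (\<lambda>y. field y $ i) \<in> borel_measurable lebesgue"
  "partial j (\<lambda>y. field y $ i) \<in> L2 \<Omega>"
proof -
  let ?f = "\<lambda>x. \<Sum>e\<in>\<E>. (weight e * edge_normal e $ i) * (indicat_real (adj_elem T e) x * bubble_grad e x $ j)"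
  have "(\<lambda>x. indicat_real (adj_elem T e) x *\<^sub>R bubble_grad e x $ j) \<in> borel_measurable lebesgue"
    if "e \<in> \<E>" for e
    by (rule measurable_cutoff[OF that]) (intro continuous_intros continuous_bubble)
  then have "?f \<in> borel_measurable lebesgue"
    by (intro borel_measurable_sum borel_measurable_times[OF borel_measurable_const]) simp
  moreover have eq: "AE x in lebesgue. ?f x = partial j (\<lambda>y. field y $ i) x"
    using AE_off_skeleton by eventually_elim (simp add: partial_bubble_field)
  ultimately show meas: "partial j (\<lambda>y. field y $ i) \<in> borel_measurable lebesgue"
    by (rule borel_measurable_AE)
  have bound: "norm (?f x) \<le> (\<Sum>e\<in>\<E>. \<bar>weight e * edge_normal e $ i\<bar> * grad_bound e)" for x
  proof -
    have "\<bar>indicat_real (adj_elem T e) x * bubble_grad e x $ j\<bar> \<le> grad_bound e" if "e \<in> \<E>" for e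
    proof (cases "x \<in> adj_elem T e")
      case True
      have "\<bar>bubble_grad e x $ j\<bar> \<le> norm (bubble_grad e x)" by (rule component_le_norm_cart)
      with True norm_bubble_grad_le[OF that True] show ?thesis by simp
    qed (simp add: grad_bound_def)
    then show ?thesis
      by (intro sum_norm_le) (auto simp: abs_mult mult.assoc intro!: mult_left_mono)
  qed
  have "AE x in lebesgue. norm (partial j (\<lambda>y. field y $ i) x)
      \<le> (\<Sum>e\<in>\<E>. \<bar>weight e * edge_normal e $ i\<bar> * grad_bound e)"
    using eq
  proof eventually_elim
    case (elim x)
    show ?case using bound[of x] unfolding elim .
  qed
  with meas show "partial j (\<lambda>y. field y $ i) \<in> L2 \<Omega>"
    using domain_facts(2) by (rule L2_bounded)
qed

lemma bubble_field_in_L2: "field \<in> L2 \<Omega>"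
proof (rule L2_bounded[OF _ _ domain_facts(2)])
  have eq: "field = (\<lambda>x. \<Sum>e\<in>\<E>. indicat_real (adj_elem T e) x *\<^sub>R ((weight e * bubble_poly e x) *\<^sub>R edge_normal e))"
    by (auto simp: bubble_field_def edge_bubble_eq mult_ac intro!: sum.cong ext)
  show "field \<in> borel_measurable lebesgue"
    unfolding eq
    by (intro borel_measurable_sum measurable_cutoff continuous_intros continuous_bubble)
  have "norm (field x) \<le> (\<Sum>e\<in>\<E>. \<bar>weight e\<bar> * norm (edge_normal e))" for x
    unfolding bubble_field_def
  proof (rule sum_norm_le)
    fix e assume e: "e \<in> \<E>"
    have "\<bar>edge_bubble T e x\<bar> \<le> 1"
      using coord_bounds[OF e, of x]
      by (cases "x \<in> adj_elem T e") (simp_all add: edge_bubble_eq[OF e] bubble_poly_def abs_mult mult_le_one)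
    then have "\<bar>weight e\<bar> * \<bar>edge_bubble T e x\<bar> \<le> \<bar>weight e\<bar>" by (simp add: mult_left_le)
    then show "norm ((weight e * edge_bubble T e x) *\<^sub>R edge_normal e) \<le> \<bar>weight e\<bar> * norm (edge_normal e)"
      by (simp add: abs_mult mult_right_mono)
  qed
  then show "AE x in lebesgue. norm (field x) \<le> (\<Sum>e\<in>\<E>. \<bar>weight e\<bar> * norm (edge_normal e))" by simp
qed

lemma bubble_field_weakly_differentiable: "weakly_differentiable_L2 \<Omega> field"
proof -
  have "has_weak_partial \<Omega> j (\<lambda>y. field y $ i) (partial j (\<lambda>y. field y $ i))" for i j
    unfolding has_weak_partial_def
  proof
    fix \<phi> assume \<phi>: "\<phi> \<in> test_functions \<Omega>"
    note \<phi>' = test_function_partial[OF \<phi>]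
    let ?c = "\<lambda>e. weight e * edge_normal e $ i"
    let ?g = "\<lambda>e x. indicat_real (adj_elem T e) x * (bubble_grad e x $ j) * \<phi> x"
    have "(LINT x|lebesgue_on \<Omega>. field x $ i * partial j \<phi> x) = (LINT x|lebesgue. field x $ i * partial j \<phi> x)"
      using test_function_outside[OF \<phi>'] by (intro integral_lebesgue_on_vanishing domain_facts) auto
    also have "\<dots> = (LINT x|lebesgue. (\<Sum>e\<in>\<E>. ?c e * (edge_bubble T e x * partial j \<phi> x)))"
      by (simp add: bubble_field_def sum_component sum_distrib_left mult_ac)
    also have "\<dots> = (\<Sum>e\<in>\<E>. ?c e * (LINT x|lebesgue. edge_bubble T e x * partial j \<phi> x))"
      using integrable_bubble_test[OF _ \<phi>'] by (subst Bochner_Integration.integral_sum) auto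
    also have "\<dots> = - (\<Sum>e\<in>\<E>. ?c e * (LINT x|lebesgue. ?g e x))"
      by (simp add: bubble_weak_partial[OF _ \<phi>] sum_negf)
    also have "(\<Sum>e\<in>\<E>. ?c e * (LINT x|lebesgue. ?g e x)) = (LINT x|lebesgue. (\<Sum>e\<in>\<E>. ?c e * ?g e x))"
      using integrable_bubble_grad_test[OF _ \<phi>] by (subst Bochner_Integration.integral_sum) auto
    also have "\<dots> = (LINT x|lebesgue. partial j (\<lambda>y. field y $ i) x * \<phi> x)"
    proof (rule integral_cong_AE)
      show "(\<lambda>x. \<Sum>e\<in>\<E>. ?c e * ?g e x) \<in> borel_measurable lebesgue"
        by (intro borel_measurable_sum borel_measurable_times borel_measurable_const
            borel_measurable_integrable[OF integrable_bubble_grad_test[OF _ \<phi>]])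
      have "\<phi> \<in> borel_measurable lborel"
        using borel_measurable_continuous_onI[OF test_function_continuous[OF \<phi>]] by simp
      then show "(\<lambda>x. partial j (\<lambda>y. field y $ i) x * \<phi> x) \<in> borel_measurable lebesgue"
        by (intro borel_measurable_times partial_bubble_field_in_L2 measurable_completion)
      show "AE x in lebesgue. (\<Sum>e\<in>\<E>. ?c e * ?g e x) = partial j (\<lambda>y. field y $ i) x * \<phi> x"
        using AE_off_skeleton
        by eventually_elim (simp add: partial_bubble_field sum_distrib_right mult.assoc)
    qed
    also have "\<dots> = (LINT x|lebesgue_on \<Omega>. partial j (\<lambda>y. field y $ i) x * \<phi> x)"
      using test_function_outside[OF \<phi>] by (intro integral_lebesgue_on_vanishing[symmetric] domain_facts) auto
    finally show "(LINT x|lebesgue_on \<Omega>. field x $ i * partial j \<phi> x)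
      = - (LINT x|lebesgue_on \<Omega>. partial j (\<lambda>y. field y $ i) x * \<phi> x)" .
  qed
  then show ?thesis
    using bubble_field_in_L2 partial_bubble_field_in_L2 by (auto simp: weakly_differentiable_L2_def)
qed

text \<open>The polynomial that represents \<open>sCurl field\<close> on \<open>K\<close>.\<close>

definition "element_tensor K x = (\<Sum>e\<in>{e\<in>\<E>. adj_elem T e = K}. weight e *\<^sub>R bubble_tensor e x)"

lemma sCurl_on_element:
  assumes "K \<in> T" "x \<in> K" "x \<notin> skeleton"
  shows "sCurl field x = element_tensor K x"
proof -
  have "sCurl field x = (\<Sum>e\<in>\<E>. (weight e * indicat_real (adj_elem T e) x) *\<^sub>R bubble_tensor e x)"
    using assms(3) by (rule sCurl_bubble_field)
  also have "\<dots> = (\<Sum>e\<in>\<E>. if adj_elem T e = K then weight e *\<^sub>R bubble_tensor e x else 0)"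
    by (rule sum.cong) (simp_all add: indicator_adj_elem[OF _ assms])
  also have "\<dots> = element_tensor K x"
    using finite_edges by (simp add: element_tensor_def sum.inter_filter)
  finally show ?thesis .
qed

lemma sCurl_AE_on_element:
  assumes "K \<in> T" shows "AE x in lebesgue_on K. sCurl field x = element_tensor K x"
proof -
  have "AE x in lebesgue. x \<in> K \<longrightarrow> sCurl field x = element_tensor K x"
    using AE_off_skeleton by eventually_elim (use sCurl_on_element[OF assms] in blast)
  then show ?thesis using element_lebesgue[OF assms] by (simp add: AE_restrict_space_iff)
qed

lemma element_tensor_in_X_local: "K \<in> T \<Longrightarrow> element_tensor K \<in> X_local"
  unfolding element_tensor_def[abs_def] bubble_tensor_def
  by (intro sum_sym_outer_in_X_local finite_edges_of_element rotated_bubble_grad_in_RT1)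

text \<open>The definite description in \<open>elem_poly\<close> is resolved by uniqueness of the representing polynomial.\<close>

lemma elem_poly_sCurl:
  assumes e: "e \<in> \<E>"
  shows "elem_poly (adj_elem T e) (sCurl field) = element_tensor (adj_elem T e)"
proof -
  let ?K = "adj_elem T e"
  note K = adj_elem_in[OF e]
  show ?thesis unfolding elem_poly_def
  proof (rule the_equality)
    show "element_tensor ?K \<in> X_local \<and> (AE x in lebesgue_on ?K. sCurl field x = element_tensor ?K x)"
      using element_tensor_in_X_local[OF K] sCurl_AE_on_element[OF K] by blast
    fix Q assume Q: "Q \<in> X_local \<and> (AE x in lebesgue_on ?K. sCurl field x = Q x)"
    have "AE x in lebesgue_on ?K. sCurl field x = Q x" using Q by blast
    then have "AE x in lebesgue_on ?K. Q x = element_tensor ?K x"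
      using sCurl_AE_on_element[OF K] by eventually_elim simp
    then show "Q = element_tensor ?K"
      using Q by (intro X_local_eq_if_AE_eq[OF _ element_tensor_in_X_local[OF K] interior_adj_elem[OF e]
          element_lebesgue[OF K]]) auto
  qed
qed

lemma trace_nn_sCurl:
  assumes e: "e \<in> \<E>" and x: "x \<in> edge_set e"
  shows "trace_nn T e (sCurl field) x = \<mu> e * edge_ell e x"
proof -
  let ?S = "{e'\<in>\<E>. adj_elem T e' = adj_elem T e}" and ?t = "edge_tangent e"
  have fin: "finite ?S" "e \<in> ?S" using finite_edges e by auto
  have "trace_nn T e (sCurl field) x = rot ?t \<bullet> (element_tensor (adj_elem T e) x *v rot ?t)"
    by (simp add: trace_nn_def Let_def elem_poly_sCurl[OF e] edge_normal_def)
  also have "\<dots> = (\<Sum>e'\<in>?S. weight e' * (rot ?t \<bullet> (bubble_tensor e' x *v rot ?t)))"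
    by (simp add: element_tensor_def inner_2 matrix_vector_mult_def sum_2 sum_component
        sum_distrib_left sum_distrib_right sum.distrib[symmetric] algebra_simps)
  also have "\<dots> = (\<Sum>e'\<in>?S. if e' = e then \<mu> e * edge_ell e x else 0)"
  proof (rule sum.cong)
    fix e' assume e': "e' \<in> ?S"
    have "rot ?t \<bullet> (bubble_tensor e' x *v rot ?t)
        = - (rot ?t \<bullet> edge_normal e') * (bubble_grad e' x \<bullet> ?t)"
      unfolding bubble_tensor_def by (rule nn_sym_outer)
    moreover have "rot ?t \<bullet> rot ?t = 1"
      using norm_edge_tangent[OF e] by (simp add: norm_rot flip: norm_eq_1)
    ultimately show "weight e' * (rot ?t \<bullet> (bubble_tensor e' x *v rot ?t)) = (if e' = e then \<mu> e * edge_ell e x else 0)"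
      using other_bubble_on_edge(1)[OF e _ _ _ x] e' bubble_on_own_edge[OF e x] edge_length_pos[OF e]
      by (auto simp: edge_normal_def)
  qed simp
  also have "\<dots> = \<mu> e * edge_ell e x" using fin by (simp add: sum.delta)
  finally show ?thesis .
qed

lemma trace_qn_sCurl:
  assumes e: "e \<in> \<E>" and x: "x \<in> edge_set e"
  shows "trace_qn T e (sCurl field) x = 0"
proof -
  let ?S = "{e'\<in>\<E>. adj_elem T e' = adj_elem T e}" and ?t = "edge_tangent e"
  define D where "D e' v = sym_part (outer (edge_normal e')
     (- rot ((grad_init e' \<bullet> v) *\<^sub>R grad_final e' + (grad_final e' \<bullet> v) *\<^sub>R grad_init e')))" for e' v
  have fin: "finite ?S" using finite_edges by auto
  have "(element_tensor (adj_elem T e) has_derivative (\<lambda>v. \<Sum>e'\<in>?S. weight e' *\<^sub>R D e' v)) (at x)"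
    unfolding element_tensor_def[abs_def] D_def
    by (intro has_derivative_sum has_derivative_scaleR_right has_derivative_bubble_tensor)
  then have "trace_qn T e (sCurl field) x = qn_form ?t (\<lambda>v. \<Sum>e'\<in>?S. weight e' *\<^sub>R D e' v)"
    unfolding trace_qn_def Let_def elem_poly_sCurl[OF e] edge_normal_def by (rule qn_form_of_derivative)
  also have "\<dots> = (\<Sum>e'\<in>?S. weight e' * qn_form ?t (D e'))" using fin by (rule qn_form_sum)
  also have "\<dots> = 0"
  proof (rule sum.neutral, rule ballI)
    fix e' assume e': "e' \<in> ?S"
    have "qn_form ?t (D e') = - 2 * (edge_normal e' \<bullet> ?t) * (grad_init e' \<bullet> ?t) * (grad_final e' \<bullet> ?t)"
      unfolding D_def[abs_def] using norm_edge_tangent[OF e] by (rule qn_form_sym_outer)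
    moreover have "edge_normal e' \<bullet> ?t = 0 \<or> (grad_init e' \<bullet> ?t) * (grad_final e' \<bullet> ?t) = 0"
    proof (cases "e' = e")
      case True
      then show ?thesis by (simp add: edge_normal_def inner_2 mult.commute)
    next
      case False
      then show ?thesis using other_bubble_on_edge(2)[OF e _ _ False x] e' by blast
    qed
    ultimately show "weight e' * qn_form ?t (D e') = 0" by auto
  qed
  finally show ?thesis .
qed

lemma sCurl_in_L2: "sCurl field \<in> L2 \<Omega>"
proof (rule L2_bounded[OF _ _ domain_facts(2)])
  let ?f = "\<lambda>x. \<Sum>e\<in>\<E>. indicat_real (adj_elem T e) x *\<^sub>R (weight e *\<^sub>R bubble_tensor e x)"
  have eq: "AE x in lebesgue. ?f x = sCurl field x"
    using AE_off_skeleton by eventually_elim (simp add: sCurl_bubble_field mult.commute)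
  have "?f \<in> borel_measurable lebesgue"
    by (intro borel_measurable_sum measurable_cutoff continuous_intros continuous_bubble_tensor)
  then show "sCurl field \<in> borel_measurable lebesgue"
    using eq by (rule borel_measurable_AE)
  have bound: "norm (?f x) \<le> (\<Sum>e\<in>\<E>. \<bar>weight e\<bar> * grad_bound e)" for x
  proof (rule sum_norm_le)
    fix e assume e: "e \<in> \<E>"
    have "indicat_real (adj_elem T e) x * norm (bubble_tensor e x) \<le> grad_bound e"
      using norm_bubble_tensor_le[OF e, of x] by (cases "x \<in> adj_elem T e") (auto simp: grad_bound_def)
    then have "\<bar>weight e\<bar> * (indicat_real (adj_elem T e) x * norm (bubble_tensor e x)) \<le> \<bar>weight e\<bar> * grad_bound e"
      by (intro mult_left_mono) auto
    then show "norm (indicat_real (adj_elem T e) x *\<^sub>R (weight e *\<^sub>R bubble_tensor e x)) \<le> \<bar>weight e\<bar> * grad_bound e"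
      by (simp add: abs_mult mult_ac)
  qed
  show "AE x in lebesgue. norm (sCurl field x) \<le> (\<Sum>e\<in>\<E>. \<bar>weight e\<bar> * grad_bound e)"
    using eq
  proof eventually_elim
    case (elim x)
    show ?case using bound[of x] unfolding elim .
  qed
qed

lemma sCurl_in_ker_divdiv: "sCurl field \<in> ker_divdiv \<Omega>"
proof -
  have "has_weak_divdiv \<Omega> (sCurl field) (\<lambda>_. 0)"
    by (rule weak_divdiv_sCurl[OF bubble_field_weakly_differentiable domain_facts(2)])
  moreover have "(\<lambda>_. 0::real) \<in> L2 \<Omega>" by (simp add: L2_def)
  ultimately show ?thesis
    using sCurl_in_L2 transpose_sCurl unfolding ker_divdiv_def H_divdiv_def by auto
qed

lemma sCurl_in_X_space: "sCurl field \<in> X_space \<Omega> T"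
  using sCurl_in_ker_divdiv element_tensor_in_X_local sCurl_AE_on_element
  unfolding X_space_def ker_divdiv_def by blast

section \<open>The stability estimate\<close>

text \<open>At most nine bubbles overlap at a point, so Cauchy-Schwarz costs a factor nine.\<close>

lemma sCurl_norm_bound:
  assumes "x \<in> \<Omega>" "x \<notin> skeleton"
  shows "(norm (sCurl field x))\<^sup>2 \<le> 9 * (\<Sum>e\<in>\<E>. (weight e * grad_bound e)\<^sup>2 * indicat_real (adj_elem T e) x)"
proof -
  have "\<Union>T = closure \<Omega>" using triangulation by (simp add: conforming_triangulation_def)
  then obtain K where K: "K \<in> T" "x \<in> K" using assms(1) closure_subset[of \<Omega>] by blast
  let ?S = "{e\<in>\<E>. adj_elem T e = K}"
  have "norm (sCurl field x) \<le> (\<Sum>e\<in>?S. \<bar>weight e\<bar> * grad_bound e)"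
    unfolding sCurl_on_element[OF K assms(2)] element_tensor_def
    using norm_bubble_tensor_le K(2) by (intro sum_norm_le) (auto intro!: mult_left_mono)
  then have "(norm (sCurl field x))\<^sup>2 \<le> (\<Sum>e\<in>?S. \<bar>weight e\<bar> * grad_bound e)\<^sup>2"
    by (intro power_mono) auto
  also have "\<dots> \<le> (\<Sum>e\<in>?S. (\<bar>weight e\<bar> * grad_bound e)\<^sup>2) * card ?S"
    by (rule sum_squared_le_sum_of_squares)
  also have "\<dots> \<le> (\<Sum>e\<in>?S. (\<bar>weight e\<bar> * grad_bound e)\<^sup>2) * 9"
    using finite_edges_of_element(2)[OF K(1)] by (intro mult_left_mono sum_nonneg) auto
  also have "(\<Sum>e\<in>?S. (\<bar>weight e\<bar> * grad_bound e)\<^sup>2) = (\<Sum>e\<in>\<E>. if adj_elem T e = K then (weight e * grad_bound e)\<^sup>2 else 0)"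
    by (simp only: sum.inter_filter[OF finite_edges] power_mult_distrib power2_abs)
  also have "\<dots> = (\<Sum>e\<in>\<E>. (weight e * grad_bound e)\<^sup>2 * indicat_real (adj_elem T e) x)"
    by (rule sum.cong) (simp_all add: indicator_adj_elem[OF _ K assms(2)])
  finally show ?thesis by (simp add: mult.commute)
qed

text \<open>With \<open>\<rho>\<close> the inball diameter and \<open>d\<close> the diameter of the triangle, the bubble gradient is at most
  \<open>2 / \<rho>\<close>, the area at most \<open>4 d\<^sup>2\<close>, and \<open>d \<le> \<sigma> \<rho>\<close>.\<close>

lemma grad_bound_measure_le:
  assumes \<sigma>: "\<And>K. K \<in> T \<Longrightarrow> diameter K \<le> \<sigma> * inball_diameter K" and e: "e \<in> \<E>"
  shows "(grad_bound e)\<^sup>2 * measure lebesgue (adj_elem T e) \<le> 16 * \<sigma>\<^sup>2"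
proof -
  let ?K = "adj_elem T e"
  have o: "orient (snd e) (apex e) (fst e) \<noteq> 0" "orient (apex e) (fst e) (snd e) \<noteq> 0"
    using orient_apex[OF e] orient_rotate by (metis less_irrefl)+
  have hull: "convex hull {snd e, apex e, fst e} = ?K" "convex hull {apex e, fst e, snd e} = ?K"
    by (simp_all add: adj_elem_eq[OF e] insert_commute)
  have comp: "compact ?K" using e by (rule compact_adj_elem)
  have a: "fst e \<in> ?K" by (simp add: adj_elem_eq[OF e] hull_inc)
  define \<rho> d where "\<rho> = inball_diameter ?K" and "d = diameter ?K"
  have \<rho>: "\<rho> \<ge> 0"
    unfolding \<rho>_def using a comp by (intro inball_diameter_nonneg compact_imp_bounded) auto
  have d: "0 \<le> d" "d \<le> \<sigma> * \<rho>"
    using \<sigma>[OF adj_elem_in[OF e]] diameter_ge_0[OF compact_imp_bounded[OF comp]]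
    by (simp_all add: d_def \<rho>_def)
  have "grad_bound e * \<rho> \<le> 2"
    using norm_bary_grad_inball[OF o(1)] norm_bary_grad_inball[OF o(2)] unfolding hull
    by (simp add: grad_bound_def grad_init_def grad_final_def \<rho>_def distrib_right)
  then have G: "(grad_bound e * \<rho>)\<^sup>2 \<le> 2\<^sup>2"
    using \<rho> by (intro power_mono) (simp_all add: grad_bound_def)
  have "?K \<subseteq> cball (fst e) d"
    using diameter_bounded_bound[OF compact_imp_bounded[OF comp] a] by (auto simp: d_def)
  then have "measure lebesgue ?K \<le> measure lebesgue (cball (fst e) d)"
    using element_lebesgue[OF adj_elem_in[OF e]] by (intro measure_mono_fmeasurable) auto
  also have "\<dots> = pi * d\<^sup>2" using d(1) by (simp add: content_cball unit_ball_vol_2)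
  also have "\<dots> \<le> 4 * d\<^sup>2" using pi_less_4 by (intro mult_right_mono) auto
  finally have "(grad_bound e)\<^sup>2 * measure lebesgue ?K \<le> (grad_bound e)\<^sup>2 * (4 * d\<^sup>2)"
    by (intro mult_left_mono) auto
  also have "\<dots> \<le> (grad_bound e)\<^sup>2 * (4 * (\<sigma> * \<rho>)\<^sup>2)"
    using d by (intro mult_left_mono power_mono) auto
  also have "\<dots> = 4 * \<sigma>\<^sup>2 * (grad_bound e * \<rho>)\<^sup>2" by (simp add: power_mult_distrib)
  also have "\<dots> \<le> 4 * \<sigma>\<^sup>2 * 2\<^sup>2" using G by (intro mult_left_mono) auto
  finally show ?thesis by simp
qed

text \<open>The constant is the square root of \<open>9 * 16 * \<sigma>\<^sup>2\<close>: nine for the overlap, sixteen for the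
  scaling of a single bubble.\<close>

lemma L2_norm_sCurl_le:
  assumes \<sigma>: "\<And>K. K \<in> T \<Longrightarrow> diameter K \<le> \<sigma> * inball_diameter K"
  shows "L2_norm \<Omega> (sCurl field) \<le> 12 * \<bar>\<sigma>\<bar> * sqrt (\<Sum>e\<in>\<E>. (edge_length e)\<^sup>2 * \<bar>\<mu> e\<bar>\<^sup>2)"
proof -
  let ?g = "\<lambda>x. 9 * (\<Sum>e\<in>\<E>. (weight e * grad_bound e)\<^sup>2 * indicat_real (adj_elem T e) x)"
  have fin: "finite_measure (lebesgue_on \<Omega>)" using domain_facts(2) by (rule finite_measure_lebesgue_on)
  have ind: "integrable (lebesgue_on \<Omega>) (indicat_real (adj_elem T e))
     \<and> (LINT x|lebesgue_on \<Omega>. indicat_real (adj_elem T e) x) \<le> measure lebesgue (adj_elem T e)" if e: "e \<in> \<E>" for e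
  proof
    have K: "adj_elem T e \<in> sets lebesgue" by (rule element_lebesgue[OF adj_elem_in[OF e]])
    have meas: "indicat_real (adj_elem T e) \<in> borel_measurable (lebesgue_on \<Omega>)"
      using K by (intro measurable_restrict_space1 borel_measurable_indicator)
    show "integrable (lebesgue_on \<Omega>) (indicat_real (adj_elem T e))"
      by (rule finite_measure.integrable_const_bound[OF fin _ meas, of 1]) (simp add: indicator_def)
    have "(LINT x|lebesgue_on \<Omega>. indicat_real (adj_elem T e) x) = measure (lebesgue_on \<Omega>) (adj_elem T e \<inter> \<Omega>)"
      by simp
    also have "\<dots> = measure lebesgue (adj_elem T e \<inter> \<Omega>)"
      using domain_facts(3) by (intro measure_restrict_space) auto
    also have "\<dots> \<le> measure lebesgue (adj_elem T e)"
      using K domain_facts(3) lmeasurable_compact[OF compact_adj_elem[OF e]]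
      by (intro measure_mono_fmeasurable) auto
    finally show "(LINT x|lebesgue_on \<Omega>. indicat_real (adj_elem T e) x) \<le> measure lebesgue (adj_elem T e)" .
  qed
  have "AE x in lebesgue. x \<in> \<Omega> \<longrightarrow> (norm (sCurl field x))\<^sup>2 \<le> ?g x"
    using AE_off_skeleton by eventually_elim (use sCurl_norm_bound in blast)
  then have ae: "AE x in lebesgue_on \<Omega>. (norm (sCurl field x))\<^sup>2 \<le> ?g x"
    using domain_facts(3) by (simp add: AE_restrict_space_iff)
  have "(LINT x|lebesgue_on \<Omega>. (norm (sCurl field x))\<^sup>2) \<le> (LINT x|lebesgue_on \<Omega>. ?g x)"
    using sCurl_in_L2 ind ae
    by (intro integral_mono_AE integrable_mult_right Bochner_Integration.integrable_sum) (auto simp: L2_def)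
  also have "\<dots> = 9 * (\<Sum>e\<in>\<E>. (weight e * grad_bound e)\<^sup>2 * (LINT x|lebesgue_on \<Omega>. indicat_real (adj_elem T e) x))"
    using ind by (subst integral_mult_right_zero, subst Bochner_Integration.integral_sum) auto
  also have "\<dots> \<le> 9 * (\<Sum>e\<in>\<E>. (weight e)\<^sup>2 * (16 * \<sigma>\<^sup>2))"
  proof (intro mult_left_mono sum_mono)
    fix e assume e: "e \<in> \<E>"
    have "(weight e * grad_bound e)\<^sup>2 * (LINT x|lebesgue_on \<Omega>. indicat_real (adj_elem T e) x)
        \<le> (weight e * grad_bound e)\<^sup>2 * measure lebesgue (adj_elem T e)"
      using ind[OF e] by (intro mult_left_mono) auto
    also have "\<dots> = (weight e)\<^sup>2 * ((grad_bound e)\<^sup>2 * measure lebesgue (adj_elem T e))"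
      by (simp add: power_mult_distrib)
    also have "\<dots> \<le> (weight e)\<^sup>2 * (16 * \<sigma>\<^sup>2)"
      using grad_bound_measure_le[OF \<sigma> e] by (intro mult_left_mono) auto
    finally show "(weight e * grad_bound e)\<^sup>2 * (LINT x|lebesgue_on \<Omega>. indicat_real (adj_elem T e) x)
        \<le> (weight e)\<^sup>2 * (16 * \<sigma>\<^sup>2)" .
  qed simp
  also have "\<dots> = (12 * \<bar>\<sigma>\<bar>)\<^sup>2 * (\<Sum>e\<in>\<E>. (edge_length e)\<^sup>2 * \<bar>\<mu> e\<bar>\<^sup>2)"
    by (simp add: power_mult_distrib sum_distrib_left mult_ac)
  finally have "L2_norm \<Omega> (sCurl field) \<le> sqrt ((12 * \<bar>\<sigma>\<bar>)\<^sup>2 * (\<Sum>e\<in>\<E>. (edge_length e)\<^sup>2 * \<bar>\<mu> e\<bar>\<^sup>2))"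
    unfolding L2_norm_def by (rule real_sqrt_le_mono)
  then show ?thesis by (simp add: real_sqrt_mult)
qed

end

end

theorem lemma4p2:
  fixes \<Omega> :: "(real^2) set" and H :: nat and \<Gamma> :: "nat \<Rightarrow> (real^2) set"
    and hs :: "real set" and \<Omega>h :: "real \<Rightarrow> (real^2) set"
    and \<Gamma>h :: "real \<Rightarrow> nat \<Rightarrow> (real^2) set" and T :: "real \<Rightarrow> (real^2) set set"
  assumes "lipschitz_domain \<Omega>"
    and "bij_betw \<Gamma> {..H} (components (frontier \<Omega>))"
    and "hs \<subseteq> {0<..}" and "0 islimpt hs"
    and "\<forall>h\<in>hs. polygonal_lipschitz_domain (\<Omega>h h)"
    and "\<forall>h\<in>hs. bij_betw (\<Gamma>h h) {..H} (components (frontier (\<Omega>h h)))"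
    and "\<forall>h\<in>hs. conforming_triangulation (\<Omega>h h) (T h)"
    and "\<forall>h\<in>hs. h = Max (diameter ` T h)"
    and "shape_regular hs T" and "quasi_uniform hs T"
    and "((\<lambda>h. hausdorff_dist (frontier (\<Omega>h h)) (frontier \<Omega>)) \<longlongrightarrow> 0) (at 0 within hs)"
    and "\<forall>i\<le>H. \<exists>\<gamma>. oriented_boundary_param \<Omega> (\<Gamma> i) \<gamma> \<and>
           (\<forall>h\<in>hs. inscribed_along \<gamma> (\<Omega>h h) (T h) (\<Gamma>h h i))"
  shows "\<exists>C. \<forall>h\<in>hs. \<forall>N\<in>X_space (\<Omega>h h) (T h). \<forall>\<mu>0 \<mu>1.
           (\<forall>e\<in>boundary_edges (\<Omega>h h) (T h). \<forall>x\<in>edge_set e.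
              trace_nn (T h) e N x = \<mu>0 e + \<mu>1 e * edge_ell e x) \<longrightarrow>
           (let p = bubble_field (\<Omega>h h) (T h) \<mu>1 in
              weakly_differentiable_L2 (\<Omega>h h) p \<and>
              sCurl p \<in> X_space (\<Omega>h h) (T h) \<inter> ker_divdiv (\<Omega>h h) \<and>
              (\<forall>e\<in>boundary_edges (\<Omega>h h) (T h). \<forall>x\<in>edge_set e.
                 trace_nn (T h) e (sCurl p) x = \<mu>1 e * edge_ell e x \<and>
                 trace_qn (T h) e (sCurl p) x = 0) \<and>
              L2_norm (\<Omega>h h) (sCurl p)
                \<le> C * sqrt (\<Sum>e\<in>boundary_edges (\<Omega>h h) (T h). (edge_length e)\<^sup>2 * \<bar>\<mu>1 e\<bar>\<^sup>2))"
proof -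
  obtain \<sigma> where \<sigma>: "\<And>h K. h \<in> hs \<Longrightarrow> K \<in> T h \<Longrightarrow> diameter K \<le> \<sigma> * inball_diameter K"
    using assms(9) unfolding shape_regular_def by blast
  have mesh: "triangulated_domain (\<Omega>h h) (T h)" if "h \<in> hs" for h
    using assms(5,7) that by (auto simp: triangulated_domain_def polygonal_lipschitz_domain_def)
  show ?thesis
    unfolding Let_def
    by (intro exI[of _ "12 * \<bar>\<sigma>\<bar>"] ballI allI impI conjI IntI
        triangulated_domain.bubble_field_weakly_differentiable triangulated_domain.sCurl_in_X_space
        triangulated_domain.sCurl_in_ker_divdiv triangulated_domain.trace_nn_sCurl
        triangulated_domain.trace_qn_sCurl triangulated_domain.L2_norm_sCurl_le mesh \<sigma>)
qed

end
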